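(* The $SU(2)$ nonlinear Fourier series, defined on finitely supported sequences, extends to a real analytic map from $\ell^1(\mathbb Z)$ to $A(\mathbb T,\mathbb C^2)$. Moreover, let $R\ge0$ and $F,F'\in\ell^1(\mathbb Z)$ with $\|F\|_{\ell^1},\|F'\|_{\ell^1}\le R$, and let $b,b'$ be the second entries of the nonlinear Fourier series of $F$ and $F'$ respectively. Then $$\|b-b'\|_A\le e^R\|F-F'\|_{\ell^1},$$ and if additionally $R\le0.36$, then $$\|F-F'\|_{\ell^1}\le 2\|b-b'\|_A.$$
   Context: $\mathbb T=\{z\in\mathbb C:|z|=1\}$. For a finitely supported $F:\mathbb Z\to\mathbb C$, its $SU(2)$ nonlinear Fourier series is the pair $(a,b)$ of functions on $\mathbb T$ given by the first row of the ordered product $\prod_k(1+|F_k|^2)^{-1/2}\begin{pmatrix}1&F_kz^k\\-\overline{F_k}z^{-k}&1\end{pmatrix}$ ($k$ increasing from left to right). The Wiener algebra $A(\mathbb T)$ is the space of functions $\sum_n c_nz^n$ on $\mathbb T$ with $(c_n)\in\ell^1(\mathbb Z)$, with norm $\|\sum c_nz^n\|_A=\sum|c_n|$. $A(\mathbb T,\mathbb C^2)$ is the space of pairs $(a,b)$ with $a,b\in A(\mathbb T)$ and norm $\|a\|_A+\|b\|_A$. *)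

theory Defs
  imports "HOL-Analysis.Analysis"
begin

type_synonym seq = "int \<Rightarrow> complex"

definition l1 :: "seq set" where
  "l1 = {F. (\<lambda>k. norm (F k)) summable_on UNIV}"

definition l1_norm :: "seq \<Rightarrow> real" where
  "l1_norm F = (\<Sum>\<^sub>\<infinity>k\<in>UNIV. norm (F k))"

definition sadd :: "seq \<Rightarrow> seq \<Rightarrow> seq" where
  "sadd f g = (\<lambda>k. f k + g k)"

definition sdiff :: "seq \<Rightarrow> seq \<Rightarrow> seq" where
  "sdiff f g = (\<lambda>k. f k - g k)"

definition sscale :: "real \<Rightarrow> seq \<Rightarrow> seq" where
  "sscale c f = (\<lambda>k. complex_of_real c * f k)"

text \<open>An element of the Wiener algebra A(T) is represented by its (unique) l^1 coefficient
  sequence c; the corresponding function on the unit circle is z \<mapsto> \<Sum>n c_n z^n,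
  and its A-norm is the l^1 norm of c.  A(T,C^2) is represented by pairs of such
  coefficient sequences, with norm ||a||_A + ||b||_A.\<close>
definition wiener_eval :: "seq \<Rightarrow> complex \<Rightarrow> complex" where
  "wiener_eval c z = (\<Sum>\<^sub>\<infinity>n\<in>UNIV. c n * z powi n)"

definition A2 :: "(seq \<times> seq) set" where
  "A2 = l1 \<times> l1"

definition A2_norm :: "seq \<times> seq \<Rightarrow> real" where
  "A2_norm p = l1_norm (fst p) + l1_norm (snd p)"

definition padd :: "seq \<times> seq \<Rightarrow> seq \<times> seq \<Rightarrow> seq \<times> seq" where
  "padd p q = (sadd (fst p) (fst q), sadd (snd p) (snd q))"

definition pdiff :: "seq \<times> seq \<Rightarrow> seq \<times> seq \<Rightarrow> seq \<times> seq" where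
  "pdiff p q = (sdiff (fst p) (fst q), sdiff (snd p) (snd q))"

definition pscale :: "real \<Rightarrow> seq \<times> seq \<Rightarrow> seq \<times> seq" where
  "pscale c p = (sscale c (fst p), sscale c (snd p))"

definition psum :: "(nat \<Rightarrow> seq \<times> seq) \<Rightarrow> nat \<Rightarrow> seq \<times> seq" where
  "psum P N = ((\<lambda>k. \<Sum>n<N. fst (P n) k), (\<lambda>k. \<Sum>n<N. snd (P n) k))"

definition real_multilinear :: "nat \<Rightarrow> (seq list \<Rightarrow> seq \<times> seq) \<Rightarrow> bool" where
  "real_multilinear n A \<longleftrightarrow>
     (\<forall>hs i u v. length hs = n \<and> i < n \<and> set hs \<subseteq> l1 \<and> u \<in> l1 \<and> v \<in> l1 \<longrightarrow>
        A (hs[i := sadd u v]) = padd (A (hs[i := u])) (A (hs[i := v]))) \<and>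
     (\<forall>hs i u c. length hs = n \<and> i < n \<and> set hs \<subseteq> l1 \<and> u \<in> l1 \<longrightarrow>
        A (hs[i := sscale c u]) = pscale c (A (hs[i := u])))"

definition multilinear_bounded :: "nat \<Rightarrow> (seq list \<Rightarrow> seq \<times> seq) \<Rightarrow> real \<Rightarrow> bool" where
  "multilinear_bounded n A C \<longleftrightarrow>
     (\<forall>hs. length hs = n \<and> set hs \<subseteq> l1 \<longrightarrow>
        A hs \<in> A2 \<and> A2_norm (A hs) \<le> C * (\<Prod>h\<leftarrow>hs. l1_norm h))"

definition real_analytic_l1_A2 :: "(seq \<Rightarrow> seq \<times> seq) \<Rightarrow> bool" where
  "real_analytic_l1_A2 \<Phi> \<longleftrightarrow>
     (\<forall>x0\<in>l1. \<exists>r>0. \<exists>(A :: nat \<Rightarrow> seq list \<Rightarrow> seq \<times> seq) (C :: nat \<Rightarrow> real).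
        (\<forall>n. real_multilinear n (A n) \<and> multilinear_bounded n (A n) (C n)) \<and>
        summable (\<lambda>n. C n * r ^ n) \<and>
        (\<forall>h\<in>l1. l1_norm h < r \<longrightarrow>
           (\<lambda>N. A2_norm (pdiff (\<Phi> (sadd x0 h)) (psum (\<lambda>n. A n (replicate n h)) N)))
             \<longlonglongrightarrow> 0))"

text \<open>2x2 complex matrices as quadruples (m11, m12, m21, m22).\<close>
type_synonym mat2 = "complex \<times> complex \<times> complex \<times> complex"

definition mat2_mult :: "mat2 \<Rightarrow> mat2 \<Rightarrow> mat2" where
  "mat2_mult M N = (case M of (a, b, c, d) \<Rightarrow> case N of (e, f, g, h) \<Rightarrow>
     (a * e + b * g, a * f + b * h, c * e + d * g, c * f + d * h))"

definition mat2_id :: mat2 where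
  "mat2_id = (1, 0, 0, 1)"

definition nlft_factor :: "seq \<Rightarrow> int \<Rightarrow> complex \<Rightarrow> mat2" where
  "nlft_factor F k z =
     (let s = complex_of_real (1 / sqrt (1 + (norm (F k))\<^sup>2)) in
       (s, s * F k * z powi k, - s * cnj (F k) * z powi (- k), s))"

definition nlft_prod :: "seq \<Rightarrow> int \<Rightarrow> int \<Rightarrow> complex \<Rightarrow> mat2" where
  "nlft_prod F lo hi z = foldl (\<lambda>M k. mat2_mult M (nlft_factor F k z)) mat2_id [lo..hi]"

end

theory Submission
  imports Defs
begin

text \<open>A matrix in SU(2) is determined by its first row, so multiplying by one more factor of the
  product, from either side, is an operation \<open>v \<mapsto> s v + B (s w) v\<close> on pairs of elements of the
  Wiener algebra. Here \<open>w\<close> is the new coefficient, \<open>s = (1 + \<bar>w\<bar>\<^sup>2)\<^sup>-\<^sup>1\<^sup>/\<^sup>2\<close>, and \<open>B\<close> is a real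
  bilinear map with \<open>\<parallel>B c v\<parallel> = \<bar>c\<bar> \<parallel>v\<parallel>\<close>. The norm of the operation is at most \<open>1 + \<bar>w\<bar>\<close>,
  which gives convergence for summable coefficients.

  For analyticity at \<open>G\<close>, every factor is expanded into a power series in the increment \<open>h\<^sub>k\<close> whose
  terms of degree \<open>n \<ge> 1\<close> are bounded by \<open>(5 \<bar>h\<^sub>k\<bar>)\<^sup>n\<close>, uniformly in the centre. Collecting the terms
  of total degree \<open>n\<close> of the product yields a (not symmetric) multilinear form of norm at most
  \<open>5\<^sup>n exp (2 \<parallel>G\<parallel>)\<close>, since the bounds of its terms occur among those of the expansion of
  \<open>\<Prod>\<^sub>i (\<Sum>\<^sub>k \<bar>h\<^sub>i\<^sub>k\<bar>)\<close>.

  The first Lipschitz estimate telescopes over the factors for \<open>F\<close> and \<open>F'\<close> close to each other,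
  where the larger of the two coefficients can be bounded with arbitrarily small loss, and then follows
  for the whole ball by subdividing segments. The lower bound holds because \<open>b(F) - F\<close> is a
  contraction with constant \<open>1/2\<close> on the ball of radius \<open>9/25\<close>.\<close>

section \<open>The Wiener algebra as a Banach space\<close>

text \<open>A type of its own makes the general theory of limits, series and linear maps in Banach
  spaces applicable to \<open>l1\<close>.\<close>

typedef wiener = l1
  morphisms coeff Wiener
  by (rule exI[of _ "\<lambda>_. 0"]) (simp add: l1_def)

setup_lifting type_definition_wiener

lemma coeff_summable: "(\<lambda>k. norm (coeff f k)) summable_on UNIV"
  using coeff[of f] by (simp add: l1_def)

lemma wiener_eqI: "(\<And>k. coeff f k = coeff g k) \<Longrightarrow> f = g"
  by transfer auto

lemma l1I_comparison:
  assumes "(\<lambda>k. b k) summable_on UNIV" "\<And>k. norm (f k) \<le> b k"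
  shows "f \<in> l1"
  unfolding l1_def mem_Collect_eq
  by (rule summable_on_comparison_test[OF assms(1)]) (use assms(2) in auto)

instantiation wiener :: real_normed_vector
begin

lift_definition zero_wiener :: wiener is "\<lambda>_. 0"
  by (simp add: l1_def)

lift_definition plus_wiener :: "wiener \<Rightarrow> wiener \<Rightarrow> wiener" is "\<lambda>f g k. f k + g k"
proof -
  fix f g :: seq assume "f \<in> l1" "g \<in> l1"
  then show "(\<lambda>k. f k + g k) \<in> l1"
    by (intro l1I_comparison[where b = "\<lambda>k. norm (f k) + norm (g k)"])
       (auto simp: l1_def intro!: summable_on_add norm_triangle_ineq)
qed

lift_definition uminus_wiener :: "wiener \<Rightarrow> wiener" is "\<lambda>f k. - f k"
  by (simp add: l1_def)

lift_definition minus_wiener :: "wiener \<Rightarrow> wiener \<Rightarrow> wiener" is "\<lambda>f g k. f k - g k"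
proof -
  fix f g :: seq assume "f \<in> l1" "g \<in> l1"
  then show "(\<lambda>k. f k - g k) \<in> l1"
    by (intro l1I_comparison[where b = "\<lambda>k. norm (f k) + norm (g k)"])
       (auto simp: l1_def intro!: summable_on_add norm_triangle_ineq4)
qed

lift_definition scaleR_wiener :: "real \<Rightarrow> wiener \<Rightarrow> wiener" is "\<lambda>c f k. c *\<^sub>R f k"
  by (auto simp: l1_def intro!: summable_on_cmult_right)

lift_definition norm_wiener :: "wiener \<Rightarrow> real" is "\<lambda>f. \<Sum>\<^sub>\<infinity>k. norm (f k)" .

definition dist_wiener :: "wiener \<Rightarrow> wiener \<Rightarrow> real" where
  "dist_wiener f g = norm (f - g)"

definition sgn_wiener :: "wiener \<Rightarrow> wiener" where
  "sgn_wiener f = inverse (norm f) *\<^sub>R f"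

definition uniformity_wiener :: "(wiener \<times> wiener) filter" where
  "uniformity_wiener = (INF e\<in>{0<..}. principal {(x, y). dist x y < e})"

definition open_wiener :: "wiener set \<Rightarrow> bool" where
  "open_wiener S = (\<forall>x\<in>S. \<forall>\<^sub>F (x', y) in uniformity. x' = x \<longrightarrow> y \<in> S)"

instance
proof
  fix f g h :: wiener and c d :: real and S :: "wiener set"
  note rep_eqs = plus_wiener.rep_eq minus_wiener.rep_eq uminus_wiener.rep_eq
    zero_wiener.rep_eq scaleR_wiener.rep_eq
  show "f + g + h = f + (g + h)" "f + g = g + f" "0 + f = f" "- f + f = 0" "f - g = f + - g"
    "c *\<^sub>R (f + g) = c *\<^sub>R f + c *\<^sub>R g" "(c + d) *\<^sub>R f = c *\<^sub>R f + d *\<^sub>R f"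
    "c *\<^sub>R d *\<^sub>R f = (c * d) *\<^sub>R f" "1 *\<^sub>R f = f"
    by (rule wiener_eqI, simp add: rep_eqs scaleR_add_right scaleR_add_left add.assoc add.commute)+
  show "dist f g = norm (f - g)" "sgn f = inverse (norm f) *\<^sub>R f"
    by (simp_all only: dist_wiener_def sgn_wiener_def)
  show "uniformity = (INF e\<in>{0<..}. principal {(x :: wiener, y). dist x y < e})"
    by (rule uniformity_wiener_def)
  show "open S = (\<forall>x\<in>S. \<forall>\<^sub>F (x', y) in uniformity. x' = x \<longrightarrow> y \<in> S)"
    by (rule open_wiener_def)
  show "norm f = 0 \<longleftrightarrow> f = 0"
  proof
    assume *: "norm f = 0"
    show "f = 0"
    proof (rule wiener_eqI)
      fix k
      have "norm (coeff f k) \<le> 0"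
        using finite_sum_le_infsum[OF coeff_summable, of "{k}" f] * by (simp add: norm_wiener.rep_eq)
      then show "coeff f k = coeff 0 k"
        by (simp add: zero_wiener.rep_eq)
    qed
  qed (simp add: norm_wiener.rep_eq zero_wiener.rep_eq)
  have "norm (f + g) \<le> (\<Sum>\<^sub>\<infinity>k. norm (coeff f k) + norm (coeff g k))"
    unfolding norm_wiener.rep_eq
    by (rule infsum_mono[OF coeff_summable summable_on_add[OF coeff_summable coeff_summable]])
       (simp add: plus_wiener.rep_eq norm_triangle_ineq)
  then show "norm (f + g) \<le> norm f + norm g"
    by (simp add: norm_wiener.rep_eq infsum_add[OF coeff_summable coeff_summable])
  show "norm (c *\<^sub>R f) = \<bar>c\<bar> * norm f"
    by (simp add: norm_wiener.rep_eq scaleR_wiener.rep_eq infsum_cmult_right')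
qed

end

lemmas coeff_simps [simp] = plus_wiener.rep_eq minus_wiener.rep_eq uminus_wiener.rep_eq
  zero_wiener.rep_eq scaleR_wiener.rep_eq

lemma sum_coeff_le_norm: "finite A \<Longrightarrow> (\<Sum>k\<in>A. norm (coeff f k)) \<le> norm f"
  unfolding norm_wiener.rep_eq by (rule finite_sum_le_infsum[OF coeff_summable]) auto

lemma norm_coeff_le: "norm (coeff f k) \<le> norm f"
  using sum_coeff_le_norm[of "{k}" f] by simp

lemma bounded_linear_coeff: "bounded_linear (\<lambda>f. coeff f k)"
  by (rule bounded_linear_intro[where K = 1]) (auto simp: norm_coeff_le)

text \<open>Bounds on finite sums survive coefficientwise limits; this is how the limit of a Cauchy
  sequence is brought back into \<open>l1\<close>.\<close>

lemma l1_normI: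
  assumes "\<And>A. finite A \<Longrightarrow> (\<Sum>k\<in>A. norm (f k)) \<le> B"
  shows "f \<in> l1" "l1_norm f \<le> B"
proof -
  have s: "(\<lambda>k. norm (f k)) summable_on UNIV"
    by (rule nonneg_bdd_above_summable_on) (auto intro!: bdd_aboveI2 assms)
  then show "f \<in> l1" by (simp add: l1_def)
  show "l1_norm f \<le> B"
    unfolding l1_norm_def by (rule infsum_le_finite_sums[OF s]) (use assms in auto)
qed

lemma norm_eq_l1_norm: "norm f = l1_norm (coeff f)"
  by (simp add: norm_wiener.rep_eq l1_norm_def)

instance wiener :: banach
proof
  fix X :: "nat \<Rightarrow> wiener"
  assume X: "Cauchy X"
  have "Cauchy (\<lambda>n. coeff (X n) k)" for k
    by (rule bounded_linear.Cauchy[OF bounded_linear_coeff X])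
  then have "\<forall>k. \<exists>l. (\<lambda>n. coeff (X n) k) \<longlonglongrightarrow> l"
    by (simp add: Cauchy_convergent_iff convergent_def)
  then obtain g where g: "\<And>k. (\<lambda>n. coeff (X n) k) \<longlonglongrightarrow> g k"
    by metis
  have tail: "\<exists>N. \<forall>m\<ge>N. (\<lambda>k. coeff (X m) k - g k) \<in> l1 \<and> l1_norm (\<lambda>k. coeff (X m) k - g k) \<le> e"
    if e: "e > 0" for e
  proof -
    obtain N where N: "\<And>m n. m \<ge> N \<Longrightarrow> n \<ge> N \<Longrightarrow> norm (X m - X n) < e"
      using CauchyD[OF X e] by blast
    \<comment> \<open>On a fixed finite index set the Cauchy estimate passes to the coefficientwise
      limit in \<open>n\<close>; \<open>l1_normI\<close> then removes the finiteness.\<close>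
    have fin: "(\<Sum>k\<in>A. norm (coeff (X m) k - g k)) \<le> e" if "m \<ge> N" "finite A" for m A
    proof (rule LIMSEQ_le_const2)
      show "(\<lambda>n. \<Sum>k\<in>A. norm (coeff (X m) k - coeff (X n) k)) \<longlonglongrightarrow> (\<Sum>k\<in>A. norm (coeff (X m) k - g k))"
        by (intro tendsto_intros g)
      show "\<exists>N. \<forall>n\<ge>N. (\<Sum>k\<in>A. norm (coeff (X m) k - coeff (X n) k)) \<le> e"
      proof (intro exI[of _ N] allI impI)
        fix n assume "n \<ge> N"
        then show "(\<Sum>k\<in>A. norm (coeff (X m) k - coeff (X n) k)) \<le> e"
          using sum_coeff_le_norm[OF \<open>finite A\<close>, of "X m - X n"] N[OF \<open>m \<ge> N\<close> \<open>n \<ge> N\<close>] by simp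
      qed
    qed
    show ?thesis
      by (intro exI[of _ N] allI impI conjI l1_normI[where B = e] fin)
  qed
  \<comment> \<open>The limit sequence differs from \<open>X N\<close> by an element of
    \<open>l1\<close>, so it lies in \<open>l1\<close> itself.\<close>
  obtain N where "(\<lambda>k. coeff (X N) k - g k) \<in> l1"
    using tail[of 1] by auto
  then have "coeff (X N - Wiener (\<lambda>k. coeff (X N) k - g k)) = g"
    unfolding minus_wiener.rep_eq by (simp add: Wiener_inverse)
  then obtain G where G: "coeff G = g" by (rule that)
  have "X \<longlonglongrightarrow> G"
  proof (rule LIMSEQ_I)
    fix e :: real assume "e > 0"
    then obtain N where "\<forall>m\<ge>N. l1_norm (\<lambda>k. coeff (X m) k - g k) \<le> e / 2"
      using tail[of "e / 2"] by auto
    then have N: "\<forall>m\<ge>N. norm (X m - G) \<le> e / 2"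
      unfolding norm_eq_l1_norm minus_wiener.rep_eq G .
    show "\<exists>N. \<forall>m\<ge>N. norm (X m - G) < e"
    proof (intro exI[of _ N] allI impI)
      fix m assume "m \<ge> N"
      then have "norm (X m - G) \<le> e / 2" using N by blast
      then show "norm (X m - G) < e" using \<open>e > 0\<close> by linarith
    qed
  qed
  then show "convergent X" by (auto simp: convergent_def)
qed

text \<open>Multiplication of the Wiener function \<open>f\<close> by \<open>c z\<^sup>k\<close>, and the involution
  taking \<open>f\<close> to its complex conjugate on the circle.\<close>

lift_definition mshift :: "int \<Rightarrow> complex \<Rightarrow> wiener \<Rightarrow> wiener" is "\<lambda>k c f n. c * f (n - k)"
proof -
  fix k :: int and c :: complex and f :: seq assume f: "f \<in> l1"
  have "(\<lambda>n. norm (f (n - k))) summable_on UNIV"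
    by (rule summable_on_reindex_bij_betw[THEN iffD2, of "\<lambda>n. n - k" UNIV UNIV "\<lambda>n. norm (f n)"])
       (use f in \<open>auto simp: l1_def intro!: bij_betwI[where g = "\<lambda>n. n + k"]\<close>)
  then show "(\<lambda>n. c * f (n - k)) \<in> l1"
    by (auto simp: l1_def o_def norm_mult intro: summable_on_cmult_right)
qed

lift_definition wstar :: "wiener \<Rightarrow> wiener" is "\<lambda>f n. cnj (f (- n))"
proof -
  fix f :: seq assume f: "f \<in> l1"
  have "(\<lambda>n. norm (f (- n))) summable_on UNIV"
    by (rule summable_on_reindex_bij_betw[THEN iffD2, of uminus UNIV UNIV "\<lambda>n. norm (f n)"])
       (use f in \<open>auto simp: l1_def intro!: bij_betwI[where g = uminus]\<close>)
  then show "(\<lambda>n. cnj (f (- n))) \<in> l1"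
    by (simp add: l1_def o_def)
qed

lemma norm_mshift: "norm (mshift k c f) = norm c * norm f"
proof -
  have "(\<Sum>\<^sub>\<infinity>n. norm (coeff f (n - k))) = (\<Sum>\<^sub>\<infinity>n. norm (coeff f n))"
    by (rule infsum_reindex_bij_betw) (auto intro!: bij_betwI[where g = "\<lambda>n. n + k"])
  then show ?thesis
    by (simp add: norm_wiener.rep_eq mshift.rep_eq norm_mult infsum_cmult_right')
qed

lemma norm_wstar: "norm (wstar f) = norm f"
proof -
  have "(\<Sum>\<^sub>\<infinity>n. norm (coeff f (- n))) = (\<Sum>\<^sub>\<infinity>n. norm (coeff f n))"
    by (rule infsum_reindex_bij_betw) (auto intro!: bij_betwI[where g = uminus])
  then show ?thesis
    by (simp add: norm_wiener.rep_eq wstar.rep_eq)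
qed

lemma mshift_add_right: "mshift k c (f + g) = mshift k c f + mshift k c g"
  and mshift_add_left: "mshift k (c + d) f = mshift k c f + mshift k d f"
  and mshift_scaleR_right: "mshift k c (r *\<^sub>R f) = r *\<^sub>R mshift k c f"
  and mshift_scaleR_left: "mshift k (r *\<^sub>R c) f = r *\<^sub>R mshift k c f"
  and wstar_add: "wstar (f + g) = wstar f + wstar g"
  and wstar_scaleR: "wstar (r *\<^sub>R f) = r *\<^sub>R wstar f"
  by (auto intro!: wiener_eqI simp: mshift.rep_eq wstar.rep_eq algebra_simps)

lift_definition wone :: wiener is "\<lambda>k. if k = 0 then 1 else 0"
  by (rule l1_normI[where B = 1]) (simp add: if_distrib[of norm] sum.delta cong: if_cong)

lemma norm_wone: "norm wone = 1"
proof -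
  have "(\<Sum>\<^sub>\<infinity>k. norm (coeff wone k)) = (\<Sum>\<^sub>\<infinity>k\<in>{0}. norm (coeff wone k))"
    by (rule infsum_cong_neutral) (auto simp: wone.rep_eq)
  then show ?thesis by (simp add: norm_wiener.rep_eq wone.rep_eq)
qed

section \<open>Power series of a single factor\<close>

definition sfac :: "complex \<Rightarrow> real" where
  "sfac w = 1 / sqrt (1 + (norm w)\<^sup>2)"

lemma sfac_0 [simp]: "sfac 0 = 1"
  by (simp add: sfac_def)

lemma sfac_pos: "0 < sfac w"
  by (simp add: sfac_def add_pos_nonneg)

lemma sfac_le_1: "sfac w \<le> 1"
  unfolding sfac_def by (subst divide_le_eq_1_pos) (auto simp: add_pos_nonneg)

lemma norm_mult_sfac_le_1: "norm w * sfac w \<le> 1"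
proof -
  have "norm w \<le> sqrt (1 + (norm w)\<^sup>2)"
    by (rule real_le_rsqrt) simp
  then have "norm w / sqrt (1 + (norm w)\<^sup>2) \<le> 1"
    by (subst divide_le_eq_1_pos) (auto simp: add_pos_nonneg)
  then show ?thesis by (simp add: sfac_def)
qed

lemma one_minus_sfac_le: "1 - sfac w \<le> (norm w)\<^sup>2 / 2"
proof -
  define r where "r = sqrt (1 + (norm w)\<^sup>2)"
  have r: "1 \<le> r" "r\<^sup>2 = 1 + (norm w)\<^sup>2"
    by (simp_all add: r_def)
  \<comment> \<open>The polynomial is \<open>r^3 - 3 r + 2\<close>, the difference of the two sides
    of the next inequality.\<close>
  have "0 \<le> (r - 1)\<^sup>2 * (r + 2)"
    using r by simp
  then have "2 * (r - 1) \<le> (r\<^sup>2 - 1) * r"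
    by (simp add: power2_eq_square algebra_simps)
  then have "(r - 1) / r \<le> (r\<^sup>2 - 1) / 2"
    using r by (simp add: divide_simps algebra_simps)
  moreover have "1 - sfac w = (r - 1) / r"
    using r by (simp add: sfac_def r_def[symmetric] diff_divide_distrib)
  ultimately show ?thesis
    using r by simp
qed

text \<open>With \<open>r\<close> and \<open>q\<close> the two square roots, the difference is
  \<open>(q - r) / (r q)\<close>, and \<open>(q - r) (q + r)\<close> equals
  \<open>|w|^2 - |v|^2\<close>. Since \<open>r\<close> and \<open>q\<close> are at least 1, the
  denominators only help.\<close>

lemma sfac_diff_le: "\<bar>sfac v - sfac w\<bar> \<le> max (norm v) (norm w) * norm (v - w)"
proof -
  define r where "r = sqrt (1 + (norm v)\<^sup>2)"
  define q where "q = sqrt (1 + (norm w)\<^sup>2)"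
  define M where "M = max (norm v) (norm w)"
  have r: "1 \<le> r" "r\<^sup>2 = 1 + (norm v)\<^sup>2" and q: "1 \<le> q" "q\<^sup>2 = 1 + (norm w)\<^sup>2"
    by (simp_all add: r_def q_def)
  have "(q - r) * (q + r) = (norm w - norm v) * (norm w + norm v)"
    using r q by (simp add: power2_eq_square algebra_simps)
  then have "\<bar>q - r\<bar> * \<bar>q + r\<bar> = \<bar>norm w - norm v\<bar> * \<bar>norm w + norm v\<bar>"
    by (simp only: abs_mult[symmetric])
  then have "\<bar>q - r\<bar> * (q + r) = \<bar>norm w - norm v\<bar> * (norm w + norm v)"
    using r q by simp
  also have "\<dots> \<le> norm (v - w) * (2 * M)"
    by (intro mult_mono) (auto simp: M_def norm_triangle_ineq3 abs_minus_commute)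
  finally have "\<bar>q - r\<bar> * 2 \<le> norm (v - w) * (2 * M)"
    using r q mult_left_mono[of 2 "q + r" "\<bar>q - r\<bar>"] by linarith
  then have *: "\<bar>q - r\<bar> \<le> M * norm (v - w)"
    by (simp add: mult.commute)
  have "sfac v - sfac w = (q - r) / (r * q)"
    using r q by (simp add: sfac_def r_def[symmetric] q_def[symmetric] divide_simps)
  then have "\<bar>sfac v - sfac w\<bar> = \<bar>q - r\<bar> / (r * q)"
    using r q by (simp add: abs_mult)
  also have "\<dots> \<le> \<bar>q - r\<bar> / 1"
    using r q mult_mono[of 1 r 1 q] by (intro divide_left_mono) auto
  finally show ?thesis
    using * by (simp add: M_def)
qed

definition bfac :: "complex \<Rightarrow> complex" where
  "bfac w = of_real (sfac w) * w"

lemma bfac_0 [simp]: "bfac 0 = 0"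
  by (simp add: bfac_def)

lemma norm_bfac_le: "norm (bfac w) \<le> norm w"
  using sfac_le_1[of w] sfac_pos[of w] mult_right_mono[of "sfac w" 1 "norm w"]
  by (simp add: bfac_def norm_mult)

text \<open>The real function \<open>x / sqrt (1 + x\<^sup>2)\<close> and its difference with \<open>x\<close> are both increasing.\<close>

lemma norm_bfac_diff_le: "norm (bfac v - bfac w) \<le> norm (v - w)"
proof -
  have *: "norm (bfac v - bfac w) \<le> norm (v - w)" if vw: "norm w \<le> norm v" for v w
  proof -
    define x y s t where "x = norm v" and "y = norm w" and "s = sfac v" and "t = sfac w"
    define c where "c = v \<bullet> w"
    have c: "c \<le> x * y" 
      using Cauchy_Schwarz_ineq2[of v w] by (simp add: c_def x_def y_def)
    have xy: "0 \<le> y" "y \<le> x" using vw by (auto simp: x_def y_def)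
    have s: "0 < s" "s \<le> 1" "0 < t" "t \<le> 1"
      by (auto simp: s_def t_def sfac_pos sfac_le_1)
    have st: "s \<le> t"
      unfolding s_def t_def sfac_def
      using vw by (intro divide_left_mono real_sqrt_le_mono add_left_mono power_mono mult_pos_pos)
        (auto simp: add_pos_nonneg)
    have "bfac v - bfac w = s *\<^sub>R v - t *\<^sub>R w"
      by (simp add: bfac_def s_def t_def scaleR_conv_of_real)
    have e1: "(norm (bfac v - bfac w))\<^sup>2 = s\<^sup>2 * x\<^sup>2 + t\<^sup>2 * y\<^sup>2 - 2 * (s * t) * c"
      unfolding \<open>bfac v - bfac w = _\<close> x_def y_def power2_norm_eq_inner c_def
      by (simp add: inner_diff_left inner_diff_right inner_commute power2_eq_square[of s]
          power2_eq_square[of t] algebra_simps)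
    have e2: "(norm (v - w))\<^sup>2 = x\<^sup>2 + y\<^sup>2 - 2 * c"
      by (simp add: power2_norm_eq_inner x_def y_def c_def inner_diff_left inner_diff_right
          inner_commute algebra_simps)
    have mono: "t * y \<le> s * x"
    proof -
      have "t * y = sqrt (y\<^sup>2 / (1 + y\<^sup>2))" "s * x = sqrt (x\<^sup>2 / (1 + x\<^sup>2))"
        using xy by (auto simp: s_def t_def sfac_def x_def y_def real_sqrt_divide)
      moreover have "y\<^sup>2 / (1 + y\<^sup>2) \<le> x\<^sup>2 / (1 + x\<^sup>2)"
        using power_mono[OF xy(2,1), of 2]
        by (simp add: divide_simps add_pos_nonneg add_nonneg_eq_0_iff algebra_simps)
      ultimately show ?thesis by simp
    qed
    have mono': "(1 - t) * y \<le> (1 - s) * x"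
      using xy s st by (intro mult_mono) auto
    \<comment> \<open>Both squared norms split into a collinear part and a multiple of
      \<open>x y - c \<ge> 0\<close>: they are \<open>(s x - t y)^2 + 2 s t (x y - c)\<close> and
      \<open>(x - y)^2 + 2 (x y - c)\<close>. The parts are compared separately.\<close>
    have "(s * x - t * y)\<^sup>2 \<le> (x - y)\<^sup>2"
      using mono mono' by (intro power_mono) (auto simp: algebra_simps)
    moreover have "2 * (1 - s * t) * c \<le> 2 * (1 - s * t) * (x * y)"
      using c s by (intro mult_left_mono) (auto simp: mult_le_one)
    ultimately have "(norm (bfac v - bfac w))\<^sup>2 \<le> (norm (v - w))\<^sup>2"
      unfolding e1 e2 by (simp add: power2_eq_square algebra_simps)
    then show ?thesis
      by (rule power2_le_imp_le) simp
  qed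
  show ?thesis
    using *[of v w] *[of w v] by (cases "norm w \<le> norm v") (auto simp: norm_minus_commute)
qed

text \<open>Splitting into \<open>(sfac v - 1) (v - w)\<close> and
  \<open>(sfac v - sfac w) w\<close> contributes 1/2 and 1 to the constant. The quadratic smallness
  near 0 is what later makes \<open>b(F) - F\<close> a contraction.\<close>

lemma norm_bfac_diff_diff_le:
  "norm ((bfac v - bfac w) - (v - w)) \<le> 3 / 2 * (max (norm v) (norm w))\<^sup>2 * norm (v - w)"
proof -
  define M where "M = max (norm v) (norm w)"
  have M: "0 \<le> M" "norm v \<le> M" "norm w \<le> M" by (auto simp: M_def le_max_iff_disj)
  have "(bfac v - bfac w) - (v - w) = of_real (sfac v - 1) * (v - w) + of_real (sfac v - sfac w) * w"
    by (simp add: bfac_def algebra_simps)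
  then have "norm ((bfac v - bfac w) - (v - w))
      \<le> norm (of_real (sfac v - 1) * (v - w)) + norm (of_real (sfac v - sfac w) * w)"
    by (metis norm_triangle_ineq)
  also have "\<dots> \<le> (M\<^sup>2 / 2) * norm (v - w) + (M * norm (v - w)) * M"
  proof (intro add_mono)
    have "1 - sfac v \<le> M\<^sup>2 / 2"
      using one_minus_sfac_le[of v] power_mono[OF M(2), of 2] by simp
    then show "norm (of_real (sfac v - 1) * (v - w)) \<le> (M\<^sup>2 / 2) * norm (v - w)"
      unfolding norm_mult norm_of_real using sfac_le_1[of v] by (intro mult_right_mono) auto
    show "norm (of_real (sfac v - sfac w) * w) \<le> (M * norm (v - w)) * M"
      unfolding norm_mult norm_of_real using M sfac_diff_le[of v w]
      by (intro mult_mono) (auto simp: M_def)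
  qed
  finally show ?thesis
    by (simp add: M_def[symmetric] power2_eq_square algebra_simps)
qed

section \<open>Taylor coefficients of a single factor as multilinear forms\<close>

definition multilin :: "('a::real_vector list \<Rightarrow> 'b::real_vector) \<Rightarrow> bool" where
  "multilin A \<longleftrightarrow> (\<forall>hs i. i < length hs \<longrightarrow> linear (\<lambda>u. A (hs[i := u])))"

text \<open>\<open>slin\<close> and \<open>squad\<close> are the coefficients in \<open>1 + |w + t
  h|^2 = (1 + |w|^2) (1 + slin w h t + squad w h h t^2)\<close>.\<close>

definition slin :: "complex \<Rightarrow> complex \<Rightarrow> real" where
  "slin w h = 2 * (w \<bullet> h) / (1 + (norm w)\<^sup>2)"

definition squad :: "complex \<Rightarrow> complex \<Rightarrow> complex \<Rightarrow> real" where
  "squad w h h' = (h \<bullet> h') / (1 + (norm w)\<^sup>2)"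

text \<open>Multilinear versions of the Taylor coefficients of \<open>sfac\<close> and \<open>bfac\<close> at \<open>w\<close>. The recursion
  expresses that \<open>t \<mapsto> sfac (w + t h)\<close> solves a first order linear differential equation.\<close>

fun sco :: "complex \<Rightarrow> complex list \<Rightarrow> real" where
  "sco w [] = sfac w"
| "sco w [h] = - (1 / 2) * slin w h * sfac w"
| "sco w (h # h' # hs) =
     - ((length hs + 3 / 2) / (length hs + 2)) * slin w h * sco w (h' # hs)
     - ((length hs + 1) / (length hs + 2)) * squad w h h' * sco w hs"

text \<open>In \<open>bfac (w + h) = sfac (w + h) * w + sfac (w + h) * h\<close> the extra factor
  \<open>h\<close> of the second product takes the first argument, so that product starts in degree
  one.\<close>

definition bco :: "complex \<Rightarrow> complex list \<Rightarrow> complex" where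
  "bco w hs = of_real (sco w hs) * w + (case hs of [] \<Rightarrow> 0 | h # t \<Rightarrow> of_real (sco w t) * h)"

lemma abs_slin_le: "\<bar>slin w h\<bar> \<le> norm h"
proof -
  have "2 * \<bar>w \<bullet> h\<bar> \<le> 2 * (norm w * norm h)"
    using Cauchy_Schwarz_ineq2[of w h] by simp
  also have "\<dots> \<le> (1 + (norm w)\<^sup>2) * norm h"
    using mult_right_mono[of "2 * norm w" "1 + (norm w)\<^sup>2" "norm h"] sum_squares_bound[of 1 "norm w"]
    by simp
  finally show ?thesis
    by (simp add: slin_def abs_mult divide_le_eq add_pos_nonneg mult.commute)
qed

lemma abs_squad_le: "\<bar>squad w h h'\<bar> \<le> norm h * norm h'"
proof -
  have "\<bar>h \<bullet> h'\<bar> / (1 + (norm w)\<^sup>2) \<le> (norm h * norm h') / 1"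
    using Cauchy_Schwarz_ineq2[of h h'] by (intro frac_le) auto
  then show ?thesis
    by (simp add: squad_def)
qed

lemma prod_list_map_nonneg: "(\<And>x. 0 \<le> f x) \<Longrightarrow> 0 \<le> (\<Prod>x\<leftarrow>xs. f x :: real)"
  by (induction xs) auto

text \<open>Both coefficients of the recursion are at most 1, so its two terms add up to three
  quarters of the bound. The factor \<open>sfac w\<close> is kept to absorb the factor
  \<open>w\<close> in \<open>bco\<close>, which makes later bounds uniform in
  \<open>w\<close>.\<close>

lemma abs_sco_le: "\<bar>sco w hs\<bar> \<le> sfac w * 2 ^ length hs * (\<Prod>h\<leftarrow>hs. norm h)"
proof (induction w hs rule: sco.induct)
  case (1 w)
  then show ?case using sfac_pos[of w] by simp
next
  case (2 w h)
  have "\<bar>slin w h\<bar> * sfac w \<le> norm h * sfac w"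
    by (intro mult_right_mono abs_slin_le less_imp_le sfac_pos)
  then have "\<bar>sco w [h]\<bar> \<le> (1 / 2) * (norm h * sfac w)"
    using sfac_pos[of w] by (simp add: abs_mult)
  also have "\<dots> \<le> 2 * (norm h * sfac w)"
    using sfac_pos[of w] by (intro mult_right_mono) auto
  finally show ?case
    by (simp add: algebra_simps)
next
  case (3 w h h' hs)
  define P where "P = sfac w * 2 ^ length hs * (norm h * (norm h' * (\<Prod>h\<leftarrow>hs. norm h)))"
  have 1: "\<bar>slin w h * sco w (h' # hs)\<bar> \<le> 2 * P"
    using mult_mono[OF abs_slin_le[of w h] "3.IH"(1)] by (simp add: abs_mult P_def algebra_simps)
  have 2: "\<bar>squad w h h' * sco w hs\<bar> \<le> P"
    using mult_mono[OF abs_squad_le[of w h h'] "3.IH"(2)] by (simp add: abs_mult P_def algebra_simps)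
  have c1: "\<bar>(length hs + 3 / 2) / (length hs + 2) :: real\<bar> \<le> 1"
    and c2: "\<bar>(length hs + 1) / (length hs + 2) :: real\<bar> \<le> 1"
    by (auto simp: divide_le_eq)
  have "\<bar>sco w (h # h' # hs)\<bar> \<le> \<bar>(length hs + 3 / 2) / (length hs + 2)\<bar> * \<bar>slin w h * sco w (h' # hs)\<bar>
      + \<bar>(length hs + 1) / (length hs + 2)\<bar> * \<bar>squad w h h' * sco w hs\<bar>"
    unfolding sco.simps abs_mult[symmetric] mult.assoc
    by (rule order_trans[OF abs_triangle_ineq4]) (simp add: abs_mult)
  also have "\<dots> \<le> 1 * (2 * P) + 1 * P"
    using 1 2 c1 c2 by (intro add_mono mult_mono) auto
  also have "\<dots> \<le> 4 * P"
    using sfac_pos[of w] by (simp add: P_def prod_list_map_nonneg)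
  finally show ?case
    by (simp add: P_def algebra_simps)
qed

text \<open>With \<open>P\<close> the product of the norms and \<open>n\<close> the length, the
  three contributions are at most 1, 1 and 1/2 times \<open>2^n P\<close>, and
  \<open>5/2 * 2^n \<le> 5^n\<close> for \<open>n \<ge> 1\<close>. In degree zero the sum can exceed
  1.\<close>

lemma sco_bco_le:
  assumes "hs \<noteq> []"
  shows "\<bar>sco w hs\<bar> + norm (bco w hs) \<le> 5 ^ length hs * (\<Prod>h\<leftarrow>hs. norm h)"
proof -
  obtain h t where hs: "hs = h # t" using assms by (cases hs) auto
  define P where "P = (\<Prod>h\<leftarrow>hs. norm h)"
  have P: "0 \<le> P" "P = norm h * (\<Prod>h\<leftarrow>t. norm h)"
    by (auto simp: P_def hs prod_list_map_nonneg)
  have 1: "\<bar>sco w hs\<bar> \<le> 1 * (2 ^ length hs * P)"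
    using abs_sco_le[of w hs] mult_right_mono[OF sfac_le_1[of w], of "2 ^ length hs * P"] P(1)
    unfolding P_def[symmetric] by (simp only: mult.assoc) (auto intro: order_trans)
  have 2: "\<bar>sco w hs\<bar> * norm w \<le> 1 * (2 ^ length hs * P)"
  proof -
    have "\<bar>sco w hs\<bar> * norm w \<le> sfac w * 2 ^ length hs * P * norm w"
      using abs_sco_le[of w hs] by (simp add: P_def mult_right_mono)
    also have "\<dots> = (norm w * sfac w) * (2 ^ length hs * P)" by simp
    also have "\<dots> \<le> 1 * (2 ^ length hs * P)"
      using P(1) norm_mult_sfac_le_1 by (intro mult_right_mono) auto
    finally show ?thesis .
  qed
  have 3: "2 * (\<bar>sco w t\<bar> * norm h) \<le> 1 * (2 ^ length hs * P)"
  proof -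
    have "\<bar>sco w t\<bar> * norm h \<le> sfac w * 2 ^ length t * (\<Prod>h\<leftarrow>t. norm h) * norm h"
      using abs_sco_le[of w t] by (simp add: mult_right_mono)
    also have "\<dots> = sfac w * (2 ^ length t * P)" by (simp add: P(2))
    also have "\<dots> \<le> 1 * (2 ^ length t * P)"
      using P(1) sfac_le_1 by (intro mult_right_mono) auto
    finally show ?thesis by (simp add: hs)
  qed
  have "norm (bco w hs) \<le> \<bar>sco w hs\<bar> * norm w + \<bar>sco w t\<bar> * norm h"
    using norm_triangle_ineq[of "of_real (sco w hs) * w" "of_real (sco w t) * h"]
    by (simp add: bco_def hs norm_mult)
  then have "\<bar>sco w hs\<bar> + norm (bco w hs) \<le> 5 / 2 * (2 ^ length hs * P)"
    using 1 2 3 by simp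
  also have "5 / 2 * 2 ^ length hs \<le> (5 / 2) ^ length hs * (2 :: real) ^ length hs"
    using self_le_power[of "5 / 2 :: real" "length hs"] hs by (intro mult_right_mono) auto
  then have "5 / 2 * (2 ^ length hs * P) \<le> 5 ^ length hs * P"
    using mult_right_mono[OF _ P(1)] by (fastforce simp: power_mult_distrib[symmetric] mult.assoc)
  finally show ?thesis by (simp add: P_def)
qed

lemma linear_slin: "linear (slin w)"
  by (rule linearI) (auto simp: slin_def inner_add_right add_divide_distrib algebra_simps)

lemma linear_squad_left: "linear (\<lambda>u. squad w u h)"
  and linear_squad_right: "linear (squad w h)"
  by (rule linearI; auto simp: squad_def inner_add_left inner_add_right add_divide_distrib)+

lemma linear_sco: "i < length hs \<Longrightarrow> linear (\<lambda>u. sco w (hs[i := u]))"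
proof (induction w hs arbitrary: i rule: sco.induct)
  case (2 w h)
  then show ?case
    using linear_slin[of w] by (auto simp: linear_iff algebra_simps)
next
  case (3 w h h' hs)
  \<comment> \<open>\<open>c\<close> and \<open>d\<close> abstract the rational coefficients, which
    depend on the length alone and are thus constants for linearity.\<close>
  obtain c d :: "nat \<Rightarrow> real" where sco3:
      "\<And>h h' t. sco w (h # h' # t) = c (length t) * slin w h * sco w (h' # t) + d (length t) * squad w h h' * sco w t"
    by (rule that[of "\<lambda>n. - ((n + 3 / 2) / (n + 2))" "\<lambda>n. - ((n + 1) / (n + 2))"]) simp
  consider "i = 0" | "i = 1" | j where "i = Suc (Suc j)"
    by (metis One_nat_def not0_implies_Suc)
  then show ?case
  proof cases
    case 1
    then show ?thesis
      using linear_slin[of w] linear_squad_left[of w h'] by (auto simp: linear_iff sco3 algebra_simps simp del: sco.simps(3))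
  next
    case 2
    then show ?thesis
      using "3.IH"(1)[of 0] linear_squad_right[of w h] by (auto simp: linear_iff sco3 algebra_simps simp del: sco.simps(3))
  next
    case (3 j)
    then show ?thesis
      using "3.IH"(1)[of "Suc j"] "3.IH"(2)[of j] "3.prems" by (auto simp: linear_iff sco3 algebra_simps simp del: sco.simps(3))
  qed
qed auto

lemma linear_bco: assumes "i < length hs" shows "linear (\<lambda>u. bco w (hs[i := u]))"
proof (cases hs)
  case (Cons h t)
  show ?thesis
  proof (cases i)
    case 0
    then show ?thesis
      using linear_sco[OF assms, of w]
      by (auto simp: linear_iff bco_def Cons algebra_simps scaleR_conv_of_real)
  next
    case (Suc j)
    then show ?thesis
      using linear_sco[OF assms, of w] linear_sco[of j t w] assms
      by (auto simp: linear_iff bco_def Cons algebra_simps scaleR_conv_of_real)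
  qed
qed (use assms in auto)

text \<open>The recursion says that \<open>y(t) = \<Sum> a_n t^n\<close> solves
  \<open>Q y' + (Q'/2) y = 0\<close> with \<open>Q(t) = 1 + \<beta> t + \<gamma> t^2\<close>, the
  equation of \<open>Q^(-1/2)\<close>. Hence \<open>y sqrt Q\<close> is constant on
  \<open>[0,1]\<close>, and comparing the endpoints gives the sum.\<close>

lemma inverse_sqrt_power_series:
  fixes a :: "nat \<Rightarrow> real" and \<beta> \<gamma> :: real
  assumes a1: "a 1 = - (1 / 2) * \<beta> * a 0"
    and rec: "\<And>n. a (n + 2) = - ((real n + 3 / 2) / (real n + 2)) * \<beta> * a (n + 1) - ((real n + 1) / (real n + 2)) * \<gamma> * a n"
    and bound: "\<And>n. \<bar>a n\<bar> \<le> K * (1 / 2) ^ n"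
    and pos: "\<And>t. 0 \<le> t \<Longrightarrow> t \<le> 1 \<Longrightarrow> 0 < 1 + \<beta> * t + \<gamma> * t\<^sup>2"
  shows "a sums (a 0 / sqrt (1 + \<beta> + \<gamma>))"
proof -
  define y where "y t = (\<Sum>n. a n * t ^ n)" for t :: real
  define y' where "y' t = (\<Sum>n. diffs a n * t ^ n)" for t :: real
  \<comment> \<open>A radius strictly between 1 and 2: differentiability at \<open>t = 1\<close>
    requires more than 1, and \<open>bound\<close> gives convergence below 2.\<close>
  have sm: "summable (\<lambda>n. a n * (3 / 2) ^ n)"
  proof (rule summable_comparison_test')
    show "summable (\<lambda>n. K * (3 / 4 :: real) ^ n)" by (intro summable_mult summable_geometric) auto
    show "norm (a n * (3 / 2) ^ n) \<le> K * (3 / 4) ^ n" for n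
      using mult_right_mono[OF bound[of n], of "(3 / 2) ^ n"]
      by (simp add: abs_mult mult.assoc power_mult_distrib[symmetric])
  qed
  have D: "(y has_field_derivative y' t) (at t)" if "0 \<le> t" "t \<le> 1" for t
    unfolding y_def y'_def by (rule termdiffs_strong[OF sm]) (use that in auto)
  have ode: "y' t * (1 + \<beta> * t + \<gamma> * t\<^sup>2) + (\<beta> / 2 + \<gamma> * t) * y t = 0" if t: "0 \<le> t" "t \<le> 1" for t
  proof -
    have s: "summable (\<lambda>n. a n * t ^ n)" and s': "summable (\<lambda>n. diffs a n * t ^ n)"
      using t powser_inside[OF sm, of t] termdiff_converges[of t "3 / 2" a] powser_inside[OF sm] by auto
    have y: "(\<lambda>n. a n * t ^ n) sums y t" and y': "(\<lambda>n. diffs a n * t ^ n) sums y' t"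
      unfolding y_def y'_def by (rule summable_sums[OF s], rule summable_sums[OF s'])
    have e1: "(\<lambda>n. a (n + 1) * t ^ (n + 1)) sums (y t - a 0)"
      using y sums_Suc_iff[of "\<lambda>n. a n * t ^ n"] by simp
    have e2: "(\<lambda>n. (real n + 2) * a (n + 2) * t ^ (n + 1)) sums (y' t - a 1)"
      using y' sums_Suc_iff[of "\<lambda>n. diffs a n * t ^ n" "y' t - a 1"]
      by (simp add: diffs_def algebra_simps)
    have e3: "(\<lambda>n. (real n + 1) * a (n + 1) * t ^ (n + 1)) sums (t * y' t)"
      using sums_mult[OF y', of t] by (simp add: diffs_def algebra_simps)
    have e4: "(\<lambda>n. real n * a n * t ^ n) sums (t * y' t)"
      using e3 sums_Suc_iff[of "\<lambda>n. real n * a n * t ^ n"] by (simp add: algebra_simps)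
    have e5: "(\<lambda>n. (real n + 1) * a n * t ^ (n + 1)) sums (t * (t * y' t + y t))"
      using sums_mult[OF sums_add[OF e4 y], of t] by (simp add: algebra_simps)
    have cancel: "c * (- (A / c) * x * x' - (B / c) * y * y') = - A * x * x' - B * y * y'"
      if "c \<noteq> 0" for c A B x x' y y' :: real
      using that by (simp add: right_diff_distrib)
    \<comment> \<open>The recursion multiplied by \<open>(n + 2) t^(n+1)\<close>, with
      \<open>n + 3/2\<close> split as \<open>(n + 1) + 1/2\<close> to match the series
      \<open>e3\<close> and \<open>e1\<close>.\<close>
    have "(real n + 2) * a (n + 2) * t ^ (n + 1) = - \<beta> * ((real n + 1) * a (n + 1) * t ^ (n + 1))
      - (\<beta> / 2) * (a (n + 1) * t ^ (n + 1)) - \<gamma> * ((real n + 1) * a n * t ^ (n + 1))" for n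
    proof -
      have *: "(real n + 2) * a (n + 2) = - (real n + 3 / 2) * \<beta> * a (n + 1) - (real n + 1) * \<gamma> * a n"
        using cancel[of "real n + 2" "real n + 3 / 2" \<beta> "a (n + 1)" "real n + 1" \<gamma> "a n"]
        unfolding rec by (simp only: minus_mult_left[symmetric])
      show ?thesis
        using arg_cong[OF *, of "\<lambda>x. x * t ^ (n + 1)"] by (simp add: algebra_simps)
    qed
    then have "(\<lambda>n. (real n + 2) * a (n + 2) * t ^ (n + 1)) sums
        (- \<beta> * (t * y' t) - (\<beta> / 2) * (y t - a 0) - \<gamma> * (t * (t * y' t + y t)))"
      using sums_diff[OF sums_diff[OF sums_mult[OF e3, of "- \<beta>"] sums_mult[OF e1, of "\<beta> / 2"]]
          sums_mult[OF e5, of \<gamma>]] by (simp only:)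
    then have "y' t - a 1 = - \<beta> * (t * y' t) - (\<beta> / 2) * (y t - a 0) - \<gamma> * (t * (t * y' t + y t))"
      using e2 sums_unique2 by blast
    then show ?thesis
      unfolding a1 by (simp add: power2_eq_square algebra_simps diff_divide_distrib)
  qed
  define Q where "Q t = 1 + \<beta> * t + \<gamma> * t\<^sup>2" for t :: real
  have "((\<lambda>t. y t * sqrt (Q t)) has_field_derivative 0) (at t within {0..1})" if t: "t \<in> {0..1}" for t
  proof -
    have Qt: "0 < Q t" using pos t by (auto simp: Q_def)
    have "((\<lambda>t. y t * sqrt (Q t)) has_field_derivative
        y' t * sqrt (Q t) + (\<beta> + 2 * \<gamma> * t) * (inverse (sqrt (Q t)) / 2) * y t) (at t)"
      unfolding Q_def using t pos[of t]
      by (auto intro!: derivative_eq_intros D simp: algebra_simps)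
    moreover have "y' t * sqrt (Q t) + (\<beta> + 2 * \<gamma> * t) * (inverse (sqrt (Q t)) / 2) * y t
      = (y' t * Q t + (\<beta> / 2 + \<gamma> * t) * y t) / sqrt (Q t)"
      using Qt by (simp add: field_simps)
    ultimately show ?thesis
      using ode[of t] t by (auto simp: Q_def intro: has_field_derivative_at_within)
  qed
  then obtain c where c: "\<And>t. t \<in> {0..1} \<Longrightarrow> y t * sqrt (Q t) = c"
    using has_field_derivative_zero_constant[of "{0..1}" "\<lambda>t. y t * sqrt (Q t)"] by auto
  have "y 1 * sqrt (Q 1) = y 0 * sqrt (Q 0)"
    using c[of 0] c[of 1] by simp
  moreover have "y 0 = a 0"
    unfolding y_def by (rule powser_zero)
  ultimately have "y 1 = a 0 / sqrt (1 + \<beta> + \<gamma>)"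
    using pos[of 1] by (simp add: Q_def field_simps)
  moreover have "a sums y 1"
    using summable_sums[OF powser_inside[OF sm, of 1]] by (simp add: y_def)
  ultimately show ?thesis by simp
qed

text \<open>The quadratic of the preceding lemma becomes
  \<open>(1 + |w + t h|^2) / (1 + |w|^2)\<close>, which is positive. Radius 1/4 turns the bound
  \<open>2^n |h|^n\<close> into the required \<open>(1/2)^n\<close>.\<close>

lemma sco_sums:
  assumes "norm h \<le> 1 / 4"
  shows "(\<lambda>n. sco w (replicate n h)) sums sfac (w + h)"
proof -
  define \<alpha> where "\<alpha> = 1 + (norm w)\<^sup>2"
  have \<alpha>: "0 < \<alpha>" by (simp add: \<alpha>_def add_pos_nonneg)
  have "1 + (norm (w + t *\<^sub>R h))\<^sup>2 = \<alpha> + 2 * (w \<bullet> h) * t + (h \<bullet> h) * t\<^sup>2" for t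
    by (simp add: \<alpha>_def power2_norm_eq_inner inner_add_left inner_add_right inner_commute
        power2_eq_square[of t])
  then have Q: "1 + slin w h * t + squad w h h * t\<^sup>2 = (1 + (norm (w + t *\<^sub>R h))\<^sup>2) / \<alpha>" for t
    using \<alpha> by (simp add: slin_def squad_def \<alpha>_def[symmetric] add_divide_distrib)
  have "(\<lambda>n. sco w (replicate n h)) sums
      (sco w (replicate 0 h) / sqrt (1 + slin w h + squad w h h))"
  proof (rule inverse_sqrt_power_series[where K = 1])
    fix n :: nat
    have "\<bar>sco w (replicate n h)\<bar> \<le> 1 * (2 ^ n * norm h ^ n)"
      using abs_sco_le[of w "replicate n h"] mult_right_mono[OF sfac_le_1[of w], of "2 ^ n * norm h ^ n"]
      by (simp only: prod_list_replicate mult.assoc map_replicate length_replicate) (auto intro: order_trans)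
    also have "2 ^ n * norm h ^ n \<le> (1 / 2) ^ n"
      unfolding power_mult_distrib[symmetric] using assms by (intro power_mono) auto
    finally show "\<bar>sco w (replicate n h)\<bar> \<le> 1 * (1 / 2) ^ n" by simp
    show "sco w (replicate (n + 2) h) = - ((real n + 3 / 2) / (real n + 2)) * slin w h * sco w (replicate (n + 1) h)
        - ((real n + 1) / (real n + 2)) * squad w h h * sco w (replicate n h)"
    proof -
      have "replicate (n + 2) h = h # h # replicate n h" "replicate (n + 1) h = h # replicate n h"
        by simp_all
      then show ?thesis
        by (simp only: sco.simps length_replicate of_nat_add of_nat_1 of_nat_numeral)
    qed
  next
    fix t :: real
    show "0 < 1 + slin w h * t + squad w h h * t\<^sup>2"
      unfolding Q using \<alpha> by (simp add: add_pos_nonneg)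
  qed simp
  moreover have "sco w (replicate 0 h) / sqrt (1 + slin w h + squad w h h) = sfac (w + h)"
    using Q[of 1] \<alpha> by (simp add: sfac_def real_sqrt_divide \<alpha>_def[symmetric])
  ultimately show ?thesis by simp
qed

lemma bco_sums:
  assumes "norm h \<le> 1 / 4"
  shows "(\<lambda>n. bco w (replicate n h)) sums bfac (w + h)"
proof -
  have s: "(\<lambda>n. complex_of_real (sco w (replicate n h))) sums of_real (sfac (w + h))"
    using sco_sums[OF assms, of w] by (rule sums_of_real)
  \<comment> \<open>A shift by one: degree \<open>n + 1\<close> of this series is degree
    \<open>n\<close> of \<open>sco\<close> times \<open>h\<close>, and degree zero vanishes.\<close>
  have "(\<lambda>n. case replicate n h of [] \<Rightarrow> 0 | h # t \<Rightarrow> of_real (sco w t) * h) sums (of_real (sfac (w + h)) * h)"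
    using sums_mult2[OF s, of h]
      sums_Suc_iff[of "\<lambda>n. case replicate n h of [] \<Rightarrow> 0 | h # t \<Rightarrow> complex_of_real (sco w t) * h"] by simp
  from sums_add[OF sums_mult2[OF s, of w] this] show ?thesis
    by (simp add: bco_def bfac_def algebra_simps)
qed

section \<open>Infinite products and their multilinear expansion\<close>

text \<open>Sums over squares converge to the product. The pairs in the square but outside the
  triangle contribute at most \<open>K\<close> times the same difference for the real series of
  norms, which tends to 0 by the scalar Cauchy product.\<close>

lemma bilinear_Cauchy_product_sums:
  fixes a :: "nat \<Rightarrow> 'a::banach" and b :: "nat \<Rightarrow> 'b::banach"
    and prod :: "'a \<Rightarrow> 'b \<Rightarrow> 'c::real_normed_vector"
  assumes bil: "bounded_bilinear prod" and a: "summable (\<lambda>k. norm (a k))" and b: "summable (\<lambda>k. norm (b k))"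
  shows "(\<lambda>k. \<Sum>i\<le>k. prod (a i) (b (k - i))) sums prod (\<Sum>k. a k) (\<Sum>k. b k)"
proof -
  interpret bounded_bilinear prod by (rule bil)
  obtain K where K: "\<And>a b. norm (prod a b) \<le> norm a * norm b * K"
    using nonneg_bounded by blast
  let ?S1 = "\<lambda>n::nat. {..<n} \<times> {..<n}"
  let ?S2 = "\<lambda>n::nat. {(i,j). i + j < n}"
  have sub: "?S2 n \<subseteq> ?S1 n" for n by auto
  have fin: "finite (?S2 n)" for n by (rule finite_subset[OF sub]) simp
  let ?g = "\<lambda>(i,j). prod (a i) (b j)"
  let ?f = "\<lambda>(i,j). norm (a i) * norm (b j)"
  have a': "summable a" and b': "summable b"
    using a b by (auto intro: summable_norm_cancel)
  have "(\<lambda>n. prod (\<Sum>k<n. a k) (\<Sum>k<n. b k)) \<longlonglongrightarrow> prod (\<Sum>k. a k) (\<Sum>k. b k)"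
    by (intro tendsto summable_LIMSEQ a' b')
  then have 1: "(\<lambda>n. sum ?g (?S1 n)) \<longlonglongrightarrow> prod (\<Sum>k. a k) (\<Sum>k. b k)"
    by (simp only: sum_left) (simp only: sum_right sum.cartesian_product)
  have "(\<lambda>n. (\<Sum>k<n. norm (a k)) * (\<Sum>k<n. norm (b k))) \<longlonglongrightarrow> (\<Sum>k. norm (a k)) * (\<Sum>k. norm (b k))"
    using a b by (intro tendsto_mult summable_LIMSEQ)
  then have f1: "(\<lambda>n. sum ?f (?S1 n)) \<longlonglongrightarrow> (\<Sum>k. norm (a k)) * (\<Sum>k. norm (b k))"
    by (simp only: sum_product sum.Sigma [rule_format] finite_lessThan)
  have f2: "(\<lambda>n. sum ?f (?S2 n)) \<longlonglongrightarrow> (\<Sum>k. norm (a k)) * (\<Sum>k. norm (b k))"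
    using Cauchy_product_sums[of "\<lambda>k. norm (a k)" "\<lambda>k. norm (b k)"] a b
    by (simp add: sums_def sum.triangle_reindex)
  have "(\<lambda>n. sum ?g (?S1 n) - sum ?g (?S2 n)) \<longlonglongrightarrow> 0"
  proof (rule Lim_null_comparison)
    show "\<forall>\<^sub>F n in sequentially. norm (sum ?g (?S1 n) - sum ?g (?S2 n))
        \<le> (sum ?f (?S1 n) - sum ?f (?S2 n)) * K"
    proof (rule always_eventually, rule allI)
      fix n
      have "norm (sum ?g (?S1 n) - sum ?g (?S2 n)) = norm (sum ?g (?S1 n - ?S2 n))"
        by (subst sum_diff[OF _ sub]) auto
      also have "\<dots> \<le> (\<Sum>x\<in>?S1 n - ?S2 n. ?f x * K)"
        by (rule sum_norm_le) (auto simp: K)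
      also have "\<dots> = (sum ?f (?S1 n) - sum ?f (?S2 n)) * K"
        by (subst sum_diff[OF _ sub, symmetric]) (auto simp: sum_distrib_right)
      finally show "norm (sum ?g (?S1 n) - sum ?g (?S2 n)) \<le> (sum ?f (?S1 n) - sum ?f (?S2 n)) * K" .
    qed
    show "(\<lambda>n. (sum ?f (?S1 n) - sum ?f (?S2 n)) * K) \<longlonglongrightarrow> 0"
      using tendsto_mult_right[OF tendsto_diff[OF f1 f2], of K] by simp
  qed
  with 1 have "(\<lambda>n. sum ?g (?S2 n)) \<longlonglongrightarrow> prod (\<Sum>k. a k) (\<Sum>k. b k)"
    by (rule Lim_transform2)
  then show ?thesis
    by (simp only: sums_def sum.triangle_reindex)
qed

text \<open>Balls are convex, so the segment stays inside; it is cut into \<open>N\<close> pieces of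
  length at most \<open>\<delta>\<close>, whose estimates add up without loss.\<close>

lemma lipschitz_on_ball_from_local:
  fixes f :: "'a::real_normed_vector \<Rightarrow> 'b::real_normed_vector"
  assumes \<delta>: "0 < \<delta>"
    and loc: "\<And>x y. norm x \<le> R \<Longrightarrow> norm y \<le> R \<Longrightarrow> norm (x - y) \<le> \<delta> \<Longrightarrow>
      norm (f x - f y) \<le> L * norm (x - y)"
    and x: "norm x \<le> R" and y: "norm y \<le> R"
  shows "norm (f x - f y) \<le> L * norm (x - y)"
proof -
  obtain N0 :: nat where N0: "norm (x - y) / \<delta> < N0"
    using reals_Archimedean2 by blast
  define N where "N = Suc N0"
  have N: "0 < real N" "norm (x - y) / N \<le> \<delta>"
    using N0 \<delta> by (auto simp: N_def field_simps intro: order_trans[OF less_imp_le])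
  define p where "p i = (1 - real i / N) *\<^sub>R x + (real i / N) *\<^sub>R y" for i
  have p: "norm (p i) \<le> R" if "i \<le> N" for i
  proof -
    have "p i \<in> cball 0 R"
      unfolding p_def using that N x y by (intro convexD_alt convex_cball) auto
    then show ?thesis by simp
  qed
  have "p i - p (Suc i) = (1 / N) *\<^sub>R (x - y)" for i
    by (simp add: p_def algebra_simps add_divide_distrib)
  then have dp: "norm (p i - p (Suc i)) = norm (x - y) / N" for i
    by simp
  have "f x - f y = f (p 0) - f (p N)"
    using N by (simp add: p_def)
  also have "\<dots> = (\<Sum>i<N. f (p i) - f (p (Suc i)))"
    by (rule sum_lessThan_telescope'[symmetric])
  also have "norm \<dots> \<le> (\<Sum>i<N. L * (norm (x - y) / N))"
    by (rule sum_norm_le, subst dp[symmetric], rule loc) (use p N dp in auto)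
  also have "\<dots> = L * norm (x - y)"
    using N by simp
  finally show ?thesis .
qed

text \<open>Expanding the product of \<open>q + p\<close> gives one term per choice of
  \<open>q\<close> or \<open>p\<close> at each position. The left side collects those choosing
  \<open>q\<close> first and \<open>p\<close> afterwards; \<open>i < length hs\<close> leaves out
  the choice of \<open>q\<close> throughout, which is subtracted on the right.\<close>

lemma sum_prod_list_take_drop_le:
  fixes q p :: "'a \<Rightarrow> real"
  assumes "\<And>h. 0 \<le> q h" "\<And>h. 0 \<le> p h"
  shows "(\<Sum>i<length hs. (\<Prod>h\<leftarrow>take i hs. q h) * (\<Prod>h\<leftarrow>drop i hs. p h))
    \<le> (\<Prod>h\<leftarrow>hs. q h + p h) - (\<Prod>h\<leftarrow>hs. q h)"
proof (induction hs)
  case (Cons h hs)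
  have "(\<Prod>h\<leftarrow>hs. p h) \<le> (\<Prod>h\<leftarrow>hs. q h + p h)"
    by (induction hs) (auto intro!: mult_mono assms prod_list_map_nonneg add_nonneg_nonneg)
  then have 1: "p h * (\<Prod>h\<leftarrow>hs. p h) \<le> p h * (\<Prod>h\<leftarrow>hs. q h + p h)"
    by (intro mult_left_mono assms)
  have "(\<Sum>i<length (h # hs). (\<Prod>h\<leftarrow>take i (h # hs). q h) * (\<Prod>h\<leftarrow>drop i (h # hs). p h))
     = p h * (\<Prod>h\<leftarrow>hs. p h) + q h * (\<Sum>i<length hs. (\<Prod>h\<leftarrow>take i hs. q h) * (\<Prod>h\<leftarrow>drop i hs. p h))"
    by (simp add: sum.lessThan_Suc_shift sum_distrib_left mult.assoc del: sum.lessThan_Suc)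
  also have "\<dots> \<le> p h * (\<Prod>h\<leftarrow>hs. q h + p h) + q h * ((\<Prod>h\<leftarrow>hs. q h + p h) - (\<Prod>h\<leftarrow>hs. q h))"
    by (intro add_mono 1 mult_left_mono Cons.IH assms)
  finally show ?case by (simp add: algebra_simps)
qed simp

text \<open>Convergence, analyticity and the first Lipschitz bound use only bilinearity and the norm
  bound of the off-diagonal part. Injectivity of \<open>\<kappa>\<close> ensures that no coefficient
  is counted twice against the \<open>l1\<close> norm.\<close>

locale transfer_steps =
  fixes B :: "nat \<Rightarrow> complex \<Rightarrow> 'v::banach \<Rightarrow> 'v" and \<kappa> :: "nat \<Rightarrow> int" and e0 :: 'v
  assumes bilin: "bounded_bilinear (B m)"
    and B_le: "norm (B m c v) \<le> norm c * norm v"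
    and inj: "inj \<kappa>"
    and norm_e0: "norm e0 = 1"
begin

lemmas B_simps = bounded_bilinear.add_left[OF bilin] bounded_bilinear.add_right[OF bilin]
  bounded_bilinear.diff_left[OF bilin] bounded_bilinear.diff_right[OF bilin]
  bounded_bilinear.scaleR_left[OF bilin] bounded_bilinear.scaleR_right[OF bilin]
  bounded_bilinear.zero_left[OF bilin] bounded_bilinear.zero_right[OF bilin]

section \<open>Partial products and their Lipschitz estimate\<close>

definition step :: "nat \<Rightarrow> complex \<Rightarrow> 'v \<Rightarrow> 'v" where
  "step m w v = sfac w *\<^sub>R v + B m (bfac w) v"

primrec U :: "wiener \<Rightarrow> nat \<Rightarrow> 'v" where
  "U F 0 = e0"
| "U F (Suc m) = step m (coeff F (\<kappa> m)) (U F m)"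

lemma norm_step_le: "norm (step m w v) \<le> (1 + norm w) * norm v"
proof -
  have "norm (step m w v) \<le> sfac w * norm v + norm (bfac w) * norm v"
    unfolding step_def using sfac_pos[of w] B_le[of m "bfac w" v]
    by (intro order_trans[OF norm_triangle_ineq] add_mono) auto
  also have "\<dots> \<le> 1 * norm v + norm w * norm v"
    by (intro add_mono mult_right_mono sfac_le_1 norm_bfac_le) auto
  finally show ?thesis by (simp add: algebra_simps)
qed

lemma norm_step_diff_le:
  "norm (step m w v - step m w' v) \<le> (1 + max (norm w) (norm w')) * norm (w - w') * norm v"
proof -
  have "norm (step m w v - step m w' v) = norm ((sfac w - sfac w') *\<^sub>R v + B m (bfac w - bfac w') v)"
    by (simp add: step_def B_simps algebra_simps)
  also have "\<dots> \<le> \<bar>sfac w - sfac w'\<bar> * norm v + norm (bfac w - bfac w') * norm v"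
    using B_le[of m "bfac w - bfac w'" v] by (intro order_trans[OF norm_triangle_ineq] add_mono) auto
  also have "\<dots> \<le> (max (norm w) (norm w') * norm (w - w')) * norm v + norm (w - w') * norm v"
    by (intro add_mono mult_right_mono sfac_diff_le norm_bfac_diff_le) auto
  finally show ?thesis by (simp add: algebra_simps)
qed

text \<open>The distance of one factor from the identity is linear in the coefficient, which makes
  the increments of the partial products summable.\<close>

lemma norm_step_minus_le: "norm (step m w v - v) \<le> 2 * norm w * norm v"
proof -
  have "1 - sfac w \<le> norm w"
  proof (cases "norm w \<le> 1")
    case True
    then show ?thesis
      using one_minus_sfac_le[of w] power_decreasing[of 1 2 "norm w"] norm_ge_zero[of w]
      by (simp del: norm_ge_zero)
  next
    case False
    then show ?thesis using sfac_pos[of w] by simp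
  qed
  then have s: "\<bar>sfac w - 1\<bar> \<le> norm w" using sfac_le_1[of w] by simp
  have "norm (step m w v - v) = norm ((sfac w - 1) *\<^sub>R v + B m (bfac w) v)"
    by (simp add: step_def algebra_simps)
  also have "\<dots> \<le> \<bar>sfac w - 1\<bar> * norm v + norm (bfac w) * norm v"
    using B_le[of m "bfac w" v] by (intro order_trans[OF norm_triangle_ineq] add_mono) auto
  also have "\<dots> \<le> norm w * norm v + norm w * norm v"
    by (intro add_mono mult_right_mono s norm_bfac_le) auto
  finally show ?thesis by (simp add: algebra_simps)
qed

lemma step_0 [simp]: "step m 0 v = v"
  by (simp add: step_def B_simps)

definition csum :: "nat \<Rightarrow> wiener \<Rightarrow> real" where
  "csum m h = (\<Sum>j<m. norm (coeff h (\<kappa> j)))"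

lemma csum_nonneg: "0 \<le> csum m h"
  by (simp add: csum_def sum_nonneg)

lemma csum_le_norm: "csum m h \<le> norm h"
proof -
  have "csum m h = (\<Sum>k\<in>\<kappa> ` {..<m}. norm (coeff h k))"
    unfolding csum_def by (subst sum.reindex) (auto intro: inj_on_subset[OF inj])
  also have "\<dots> \<le> norm h" by (rule sum_coeff_le_norm) simp
  finally show ?thesis .
qed

lemma csum_0 [simp]: "csum 0 h = 0"
  and csum_Suc: "csum (Suc m) h = csum m h + norm (coeff h (\<kappa> m))"
  by (simp_all add: csum_def)

lemma norm_U_le: "norm (U F m) \<le> exp (csum m F)"
proof (induction m)
  case (Suc m)
  have "norm (U F (Suc m)) \<le> (1 + norm (coeff F (\<kappa> m))) * norm (U F m)"
    by (simp add: norm_step_le)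
  also have "\<dots> \<le> exp (norm (coeff F (\<kappa> m))) * exp (csum m F)"
    by (intro mult_mono exp_ge_add_one_self Suc.IH) auto
  finally show ?case by (simp add: csum_Suc exp_add mult.commute)
qed (simp add: norm_e0)

text \<open>The exponent majorizes the partial norms of both sequences, so one exponential absorbs
  all other factors in the telescoping. Its excess over \<open>csum m F\<close> is at most the
  distance of the sequences, hence negligible for close ones.\<close>

lemma norm_U_diff_le:
  "norm (U F m - U F' m) \<le> exp (csum m F + csum m (F - F')) * csum m (F - F')"
proof (induction m)
  case (Suc m)
  define w w' where "w = coeff F (\<kappa> m)" and "w' = coeff F' (\<kappa> m)"
  define S where "S = csum m F + csum m (F - F')"
  define d where "d = norm w + norm (w - w')"
  have M: "max (norm w) (norm w') \<le> d"
    using norm_triangle_sub[of w' w] by (auto simp: d_def norm_minus_commute)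
  have e: "1 + d \<le> exp d" by (rule exp_ge_add_one_self)
  have S': "csum m F' \<le> S"
    unfolding S_def csum_def sum.distrib[symmetric]
    by (rule sum_mono) (use norm_triangle_sub norm_minus_commute in \<open>metis minus_wiener.rep_eq\<close>)
  have "norm (step m w (U F m) - step m w' (U F' m))
     \<le> norm (step m w (U F m - U F' m)) + norm (step m w (U F' m) - step m w' (U F' m))"
    by (rule order_trans[OF _ norm_triangle_ineq]) (simp add: step_def B_simps algebra_simps)
  also have "\<dots> \<le> (1 + norm w) * norm (U F m - U F' m)
      + (1 + max (norm w) (norm w')) * norm (w - w') * norm (U F' m)"
    by (intro add_mono norm_step_le norm_step_diff_le)
  also have "\<dots> \<le> exp d * (exp S * csum m (F - F')) + exp d * norm (w - w') * exp S"
  proof (intro add_mono mult_mono)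
    show "1 + norm w \<le> exp d" using e by (rule order_trans[rotated]) (simp add: d_def)
    show "1 + max (norm w) (norm w') \<le> exp d" using M e by linarith
    show "norm (U F' m) \<le> exp S" using norm_U_le[of F' m] S' by (meson exp_le_cancel_iff order_trans)
  qed (use Suc.IH in \<open>auto simp: S_def\<close>)
  also have "\<dots> = exp (S + d) * (csum m (F - F') + norm (w - w'))"
    by (simp add: exp_add algebra_simps)
  also have "\<dots> = exp (csum (Suc m) F + csum (Suc m) (F - F')) * csum (Suc m) (F - F')"
    by (simp add: csum_Suc S_def d_def w_def w'_def add_ac)
  finally show ?case by (simp add: w_def w'_def)
qed simp

text \<open>Substituting the power series of every step into the recursion for \<^term>\<open>U\<close> and collecting
  terms, the multilinear part of \<open>U (G + h) m\<close> of degree \<open>n\<close> is \<open>V G m\<close> on lists of length \<open>n\<close>.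
  The last \<open>n - i\<close> arguments are consumed by the last step.\<close>

definition stepco :: "wiener \<Rightarrow> nat \<Rightarrow> wiener list \<Rightarrow> 'v \<Rightarrow> 'v" where
  "stepco G m hs v =
     sco (coeff G (\<kappa> m)) (map (\<lambda>h. coeff h (\<kappa> m)) hs) *\<^sub>R v +
     B m (bco (coeff G (\<kappa> m)) (map (\<lambda>h. coeff h (\<kappa> m)) hs)) v"

primrec V :: "wiener \<Rightarrow> nat \<Rightarrow> wiener list \<Rightarrow> 'v" where
  "V G 0 = (\<lambda>hs. if hs = [] then e0 else 0)"
| "V G (Suc m) = (\<lambda>hs. \<Sum>i\<le>length hs. stepco G m (drop i hs) (V G m (take i hs)))"

lemma stepco_Nil: "stepco G m [] v = step m (coeff G (\<kappa> m)) v"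
  by (simp add: stepco_def step_def bco_def bfac_def)

lemma V_Nil: "V G m [] = U G m"
  by (induction m) (simp_all add: stepco_Nil)

lemma norm_stepco_le:
  assumes "hs \<noteq> []"
  shows "norm (stepco G m hs v) \<le> 5 ^ length hs * (\<Prod>h\<leftarrow>hs. norm (coeff h (\<kappa> m))) * norm v"
proof -
  let ?w = "coeff G (\<kappa> m)" and ?hs = "map (\<lambda>h. coeff h (\<kappa> m)) hs"
  have "norm (stepco G m hs v) \<le> \<bar>sco ?w ?hs\<bar> * norm v + norm (bco ?w ?hs) * norm v"
    unfolding stepco_def using B_le by (intro order_trans[OF norm_triangle_ineq] add_mono) auto
  also have "\<dots> \<le> 5 ^ length hs * (\<Prod>h\<leftarrow>hs. norm (coeff h (\<kappa> m))) * norm v"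
    using mult_right_mono[OF sco_bco_le[of ?hs ?w], of "norm v"] assms
    by (simp add: algebra_simps o_def)
  finally show ?thesis .
qed

text \<open>A majorant whose increments in \<open>m\<close> dominate those of \<open>V\<close> and
  which stays bounded in \<open>m\<close>; it yields both the bounds and the convergence.\<close>

definition maj :: "wiener \<Rightarrow> nat \<Rightarrow> wiener list \<Rightarrow> real" where
  "maj G m hs = (\<Prod>j<m. 1 + 2 * norm (coeff G (\<kappa> j))) * 5 ^ length hs * (\<Prod>h\<leftarrow>hs. csum m h)"

lemma maj_nonneg: "0 \<le> maj G m hs"
  unfolding maj_def by (intro mult_nonneg_nonneg prod_nonneg prod_list_map_nonneg csum_nonneg) auto

text \<open>In the term \<open>i = length hs\<close> the last step consumes no argument, so after
  subtracting \<open>V G m hs\<close> it is a factor minus the identity, of size \<open>2 x\<close>.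
  The other terms are summed by \<open>sum_prod_list_take_drop_le\<close>.\<close>

lemma norm_V_Suc_diff_le:
  assumes IH: "\<And>hs. norm (V G m hs) \<le> maj G m hs"
  shows "norm (V G (Suc m) hs - V G m hs) \<le> maj G (Suc m) hs - maj G m hs"
proof -
  define x where "x = norm (coeff G (\<kappa> m))"
  define E where "E = (\<Prod>j<m. 1 + 2 * norm (coeff G (\<kappa> j)))"
  define n where "n = length hs"
  define p where "p h = norm (coeff h (\<kappa> m))" for h
  define q where "q = csum m"
  have E: "0 \<le> E" unfolding E_def by (intro prod_nonneg) auto
  have pq: "0 \<le> p h" "0 \<le> q h" for h by (auto simp: p_def q_def csum_nonneg)
  have x: "0 \<le> x" by (simp add: x_def)
  have Pq: "0 \<le> (\<Prod>h\<leftarrow>hs. q h)" "(\<Prod>h\<leftarrow>hs. q h) \<le> (\<Prod>h\<leftarrow>hs. q h + p h)"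
    using sum_prod_list_take_drop_le[of q p hs] pq
      sum_nonneg[of "{..<length hs}" "\<lambda>i. (\<Prod>h\<leftarrow>take i hs. q h) * (\<Prod>h\<leftarrow>drop i hs. p h)"]
    by (auto simp: prod_list_map_nonneg)
  have split: "V G (Suc m) hs - V G m hs = (stepco G m [] (V G m hs) - V G m hs)
      + (\<Sum>i<n. stepco G m (drop i hs) (V G m (take i hs)))"
    by (simp add: n_def lessThan_Suc_atMost[symmetric])
  have "norm (V G (Suc m) hs - V G m hs) \<le> norm (stepco G m [] (V G m hs) - V G m hs)
      + (\<Sum>i<n. norm (stepco G m (drop i hs) (V G m (take i hs))))"
    unfolding split by (intro order_trans[OF norm_triangle_ineq] add_left_mono norm_sum)
  also have "\<dots> \<le> 2 * x * (E * 5 ^ n * (\<Prod>h\<leftarrow>hs. q h))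
      + (\<Sum>i<n. E * 5 ^ n * ((\<Prod>h\<leftarrow>take i hs. q h) * (\<Prod>h\<leftarrow>drop i hs. p h)))"
  proof (rule add_mono[OF _ sum_mono])
    have "norm (stepco G m [] (V G m hs) - V G m hs) \<le> 2 * x * norm (V G m hs)"
      unfolding stepco_Nil x_def by (rule norm_step_minus_le)
    also have "\<dots> \<le> 2 * x * (E * 5 ^ n * (\<Prod>h\<leftarrow>hs. q h))"
      using IH[of hs] x by (intro mult_left_mono) (auto simp: maj_def E_def n_def q_def)
    finally show "norm (stepco G m [] (V G m hs) - V G m hs) \<le> 2 * x * (E * 5 ^ n * (\<Prod>h\<leftarrow>hs. q h))" .
  next
    fix i assume i: "i \<in> {..<n}"
    have "norm (stepco G m (drop i hs) (V G m (take i hs)))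
        \<le> 5 ^ (n - i) * (\<Prod>h\<leftarrow>drop i hs. p h) * norm (V G m (take i hs))"
      using norm_stepco_le[of "drop i hs" G m] i by (simp add: n_def p_def)
    also have "\<dots> \<le> 5 ^ (n - i) * (\<Prod>h\<leftarrow>drop i hs. p h) * (E * 5 ^ i * (\<Prod>h\<leftarrow>take i hs. q h))"
      using IH[of "take i hs"] i pq
      by (intro mult_left_mono) (auto simp: maj_def E_def n_def q_def min_def prod_list_map_nonneg)
    also have "\<dots> = E * (5 ^ (n - i) * 5 ^ i) * ((\<Prod>h\<leftarrow>take i hs. q h) * (\<Prod>h\<leftarrow>drop i hs. p h))"
      by simp
    also have "(5 :: real) ^ (n - i) * 5 ^ i = 5 ^ n"
      using i by (simp add: power_add[symmetric])
    finally show "norm (stepco G m (drop i hs) (V G m (take i hs)))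
      \<le> E * 5 ^ n * ((\<Prod>h\<leftarrow>take i hs. q h) * (\<Prod>h\<leftarrow>drop i hs. p h))" .
  qed
  also have "\<dots> = E * 5 ^ n * (2 * x * (\<Prod>h\<leftarrow>hs. q h)
      + (\<Sum>i<length hs. (\<Prod>h\<leftarrow>take i hs. q h) * (\<Prod>h\<leftarrow>drop i hs. p h)))"
    unfolding sum_distrib_left[symmetric] n_def by (simp only: distrib_left mult_ac)
  \<comment> \<open>Enlarging \<open>q\<close> to \<open>q + p\<close> in the first term makes the
    right side an exact increment of \<open>maj\<close>.\<close>
  also have "\<dots> \<le> E * 5 ^ n * (2 * x * (\<Prod>h\<leftarrow>hs. q h + p h)
      + ((\<Prod>h\<leftarrow>hs. q h + p h) - (\<Prod>h\<leftarrow>hs. q h)))"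
    using E x Pq pq by (intro mult_left_mono add_mono sum_prod_list_take_drop_le) auto
  also have "\<dots> = maj G (Suc m) hs - maj G m hs"
    by (simp add: maj_def E_def[symmetric] n_def x_def csum_Suc p_def q_def algebra_simps)
  finally show ?thesis .
qed

lemma norm_V_le_maj: "norm (V G m hs) \<le> maj G m hs"
proof (induction m arbitrary: hs)
  case 0
  then show ?case by (cases hs) (auto simp: maj_def norm_e0)
next
  case (Suc m)
  have "norm (V G (Suc m) hs) \<le> norm (V G (Suc m) hs - V G m hs) + norm (V G m hs)"
    by (metis diff_add_cancel norm_triangle_ineq)
  with norm_V_Suc_diff_le[OF Suc, of hs] Suc[of hs] show ?case by linarith
qed

lemma maj_le: "maj G m hs \<le> exp (2 * norm G) * 5 ^ length hs * (\<Prod>h\<leftarrow>hs. norm h)"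
proof -
  have "(\<Prod>j<m. 1 + 2 * norm (coeff G (\<kappa> j))) \<le> (\<Prod>j<m. exp (2 * norm (coeff G (\<kappa> j))))"
    by (intro prod_mono conjI exp_ge_add_one_self) auto
  also have "\<dots> = exp (2 * csum m G)"
    by (simp add: exp_sum[symmetric] csum_def sum_distrib_left)
  also have "\<dots> \<le> exp (2 * norm G)" using csum_le_norm[of m G] by simp
  finally have 1: "(\<Prod>j<m. 1 + 2 * norm (coeff G (\<kappa> j))) \<le> exp (2 * norm G)" .
  have 2: "(\<Prod>h\<leftarrow>hs. csum m h) \<le> (\<Prod>h\<leftarrow>hs. norm h)"
    by (induction hs) (auto intro!: mult_mono csum_le_norm prod_list_map_nonneg csum_nonneg)
  show ?thesis
    unfolding maj_def
    by (intro mult_mono 1 2 mult_nonneg_nonneg prod_list_map_nonneg csum_nonneg) auto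
qed

lemma norm_V_le: "norm (V G m hs) \<le> exp (2 * norm G) * 5 ^ length hs * (\<Prod>h\<leftarrow>hs. norm h)"
  using norm_V_le_maj maj_le by (rule order_trans)

lemma convergent_V: "convergent (\<lambda>m. V G m hs)"
proof -
  have "summable (\<lambda>m. V G (Suc m) hs - V G m hs)"
  proof (rule summable_norm_cancel, rule bounded_imp_summable)
    fix N
    have "(\<Sum>m\<le>N. norm (V G (Suc m) hs - V G m hs)) \<le> (\<Sum>m<Suc N. maj G (Suc m) hs - maj G m hs)"
      unfolding lessThan_Suc_atMost by (intro sum_mono norm_V_Suc_diff_le norm_V_le_maj)
    also have "\<dots> = maj G (Suc N) hs - maj G 0 hs"
      by (rule sum_lessThan_telescope)
    also have "\<dots> \<le> exp (2 * norm G) * 5 ^ length hs * (\<Prod>h\<leftarrow>hs. norm h)"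
      using maj_le[of G "Suc N" hs] maj_nonneg[of G 0 hs] by linarith
    finally show "(\<Sum>m\<le>N. norm (V G (Suc m) hs - V G m hs))
      \<le> exp (2 * norm G) * 5 ^ length hs * (\<Prod>h\<leftarrow>hs. norm h)" .
  qed simp
  then have "(\<lambda>N. \<Sum>m<N. V G (Suc m) hs - V G m hs) \<longlonglongrightarrow> (\<Sum>m. V G (Suc m) hs - V G m hs)"
    by (rule summable_LIMSEQ)
  then have "(\<lambda>N. V G N hs - V G 0 hs) \<longlonglongrightarrow> (\<Sum>m. V G (Suc m) hs - V G m hs)"
    by (simp only: sum_lessThan_telescope[of "\<lambda>m. V G m hs"])
  from tendsto_add[OF this tendsto_const[of "V G 0 hs"]] show ?thesis
    by (auto simp: convergent_def)
qed

section \<open>Limits of the partial products and of their multilinear parts\<close>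

definition Vlim :: "wiener \<Rightarrow> wiener list \<Rightarrow> 'v" where
  "Vlim G hs = lim (\<lambda>m. V G m hs)"

definition Ulim :: "wiener \<Rightarrow> 'v" where
  "Ulim F = lim (U F)"

lemma V_tendsto: "(\<lambda>m. V G m hs) \<longlonglongrightarrow> Vlim G hs"
  unfolding Vlim_def using convergent_V by (simp add: convergent_LIMSEQ_iff)

lemma U_tendsto: "U F \<longlonglongrightarrow> Ulim F"
  unfolding Ulim_def using convergent_V[of F "[]"] by (simp add: V_Nil convergent_LIMSEQ_iff)

lemma norm_Vlim_le: "norm (Vlim G hs) \<le> exp (2 * norm G) * 5 ^ length hs * (\<Prod>h\<leftarrow>hs. norm h)"
  by (rule LIMSEQ_le_const2[OF tendsto_norm[OF V_tendsto]]) (auto intro: norm_V_le)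

lemma linear_stepco: "linear (stepco G m hs)"
  by (rule linearI) (auto simp: stepco_def B_simps algebra_simps)

lemma linear_stepco_arg: "i < length hs \<Longrightarrow> linear (\<lambda>u. stepco G m (hs[i := u]) v)"
  using linear_sco[of i "map (\<lambda>h. coeff h (\<kappa> m)) hs" "coeff G (\<kappa> m)"]
    linear_bco[of i "map (\<lambda>h. coeff h (\<kappa> m)) hs" "coeff G (\<kappa> m)"]
  by (auto simp: linear_iff stepco_def B_simps map_update algebra_simps)

lemma multilin_V: "multilin (V G m)"
proof (induction m)
  case 0
  then show ?case by (auto simp: multilin_def intro!: linear_zero)
next
  case (Suc m)
  show ?case
    unfolding multilin_def
  proof (intro allI impI)
    fix hs :: "wiener list" and j assume j: "j < length hs"
    have "linear (\<lambda>u. stepco G m (drop i (hs[j := u])) (V G m (take i (hs[j := u]))))"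
      if "i \<le> length hs" for i
    proof (cases "j < i")
      case True
      then have "linear (\<lambda>u. V G m ((take i hs)[j := u]))"
        using Suc.IH j that by (auto simp: multilin_def)
      from linear_compose[OF this linear_stepco[of G m "drop i hs"]] show ?thesis
        using True by (simp add: take_update_swap o_def)
    next
      case False
      then show ?thesis
        using linear_stepco_arg[of "j - i" "drop i hs" G m "V G m (take i hs)"] j
        by (simp add: drop_update_swap)
    qed
    then show "linear (\<lambda>u. V G (Suc m) (hs[j := u]))"
      by (simp add: linear_compose_sum)
  qed
qed

lemma multilin_Vlim: "multilin (Vlim G)"
  unfolding multilin_def
proof (intro allI impI)
  fix hs :: "wiener list" and j assume j: "j < length hs"
  have lin: "linear (\<lambda>u. V G m (hs[j := u]))" for m
    using multilin_V j by (auto simp: multilin_def)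
  show "linear (\<lambda>u. Vlim G (hs[j := u]))"
  proof (rule linearI)
    fix u v :: wiener and c :: real
    have "(\<lambda>m. V G m (hs[j := u + v])) \<longlonglongrightarrow> Vlim G (hs[j := u]) + Vlim G (hs[j := v])"
      unfolding linear_add[OF lin] by (intro tendsto_add V_tendsto)
    then show "Vlim G (hs[j := u + v]) = Vlim G (hs[j := u]) + Vlim G (hs[j := v])"
      using V_tendsto LIMSEQ_unique by blast
    have "(\<lambda>m. V G m (hs[j := c *\<^sub>R u])) \<longlonglongrightarrow> c *\<^sub>R Vlim G (hs[j := u])"
      unfolding linear_scale[OF lin] by (intro tendsto_intros V_tendsto)
    then show "Vlim G (hs[j := c *\<^sub>R u]) = c *\<^sub>R Vlim G (hs[j := u])"
      using V_tendsto LIMSEQ_unique by blast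
  qed
qed

text \<open>Radius 1/10 makes the ratio \<open>5 |h|\<close> at most 1/2; it also lies within the
  radius 1/4 of the single-factor series.\<close>

lemma norm_V_replicate_le:
  assumes "norm h \<le> 1 / 10"
  shows "norm (V G m (replicate n h)) \<le> exp (2 * norm G) * (1 / 2) ^ n"
proof -
  have "norm (V G m (replicate n h)) \<le> exp (2 * norm G) * (5 ^ n * norm h ^ n)"
    using norm_V_le[of G m "replicate n h"] by (simp add: prod_list_replicate mult.assoc)
  also have "5 ^ n * norm h ^ n \<le> (1 / 2) ^ n"
    unfolding power_mult_distrib[symmetric] using assms by (intro power_mono) auto
  finally show ?thesis by simp
qed

lemma V_replicate_sums:
  assumes h: "norm h \<le> 1 / 10"
  shows "(\<lambda>n. V G m (replicate n h)) sums U (G + h) m"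
proof (induction m)
  case 0
  have "(\<lambda>n. V G 0 (replicate n h)) = (\<lambda>n. if n = 0 then e0 else 0)"
    by auto
  then show ?case using sums_single[of 0 "\<lambda>_. e0"] by simp
next
  case (Suc m)
  define w c where "w = coeff G (\<kappa> m)" and "c = coeff h (\<kappa> m)"
  have c: "norm c \<le> 1 / 10" using norm_coeff_le[of h "\<kappa> m"] h by (simp add: c_def)
  have geo: "summable (\<lambda>n. K * (1 / 2 :: real) ^ n)" for K
    by (intro summable_mult summable_geometric) auto
  have pw: "5 ^ n * norm c ^ n \<le> (1 / 2) ^ n" for n
    unfolding power_mult_distrib[symmetric] using c by (intro power_mono) auto
  have V: "summable (\<lambda>n. norm (V G m (replicate n h)))"
    by (rule summable_comparison_test'[OF geo[of "exp (2 * norm G)"], of 0])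
       (simp add: norm_V_replicate_le[OF h])
  \<comment> \<open>Degree zero is separate: there the bounds are \<open>sfac w \<le> 1\<close> and
    \<open>|w| sfac w \<le> 1\<close>.\<close>
  have sb: "\<bar>sco w (replicate n c)\<bar> \<le> 1 * (1 / 2) ^ n \<and> norm (bco w (replicate n c)) \<le> 1 * (1 / 2) ^ n" for n
  proof (cases "n = 0")
    case True
    then show ?thesis
      using sfac_le_1[of w] sfac_pos[of w] norm_mult_sfac_le_1[of w]
      by (simp add: bco_def norm_mult mult.commute)
  next
    case False
    then show ?thesis
      using sco_bco_le[of "replicate n c" w] pw[of n] norm_ge_zero[of "bco w (replicate n c)"]
        abs_ge_zero[of "sco w (replicate n c)"]
      by (simp add: prod_list_replicate del: norm_ge_zero abs_ge_zero)
  qed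
  have s: "summable (\<lambda>n. norm (sco w (replicate n c)))" and b: "summable (\<lambda>n. norm (bco w (replicate n c)))"
    by (rule summable_comparison_test'[OF geo[of 1], of 0]; use sb in simp)+
  have c4: "norm c \<le> 1 / 4" using c by simp
  \<comment> \<open>The recursion for \<open>V\<close> on a constant list is a Cauchy product:
    \<open>V\<close> takes the first \<open>i\<close> arguments and the step the remaining
    \<open>k - i\<close>. The arguments of the bilinear maps are flipped to match this
    order.\<close>
  have "(\<lambda>k. (\<Sum>i\<le>k. sco w (replicate (k - i) c) *\<^sub>R V G m (replicate i h)) +
        (\<Sum>i\<le>k. B m (bco w (replicate (k - i) c)) (V G m (replicate i h))))
      sums (sfac (w + c) *\<^sub>R U (G + h) m + B m (bfac (w + c)) (U (G + h) m))"
    using sums_add[OF bilinear_Cauchy_product_sums[OF bounded_bilinear.flip[OF bounded_bilinear_scaleR] V s]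
      bilinear_Cauchy_product_sums[OF bounded_bilinear.flip[OF bilin[of m]] V b]]
    unfolding sums_unique[OF Suc.IH, symmetric] sums_unique[OF sco_sums[OF c4], symmetric]
      sums_unique[OF bco_sums[OF c4], symmetric] .
  then show ?case
    by (simp add: stepco_def sum.distrib w_def c_def step_def)
qed

text \<open>The geometric tail bound is independent of \<open>m\<close>, so \<open>m\<close> can
  tend to infinity with \<open>N\<close> fixed.\<close>

lemma norm_Ulim_minus_Vlim_le:
  assumes h: "norm h \<le> 1 / 10"
  shows "norm (Ulim (G + h) - (\<Sum>n<N. Vlim G (replicate n h))) \<le> exp (2 * norm G) * 2 * (1 / 2) ^ N"
proof (rule LIMSEQ_le_const2)
  show "(\<lambda>m. norm (U (G + h) m - (\<Sum>n<N. V G m (replicate n h))))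
      \<longlonglongrightarrow> norm (Ulim (G + h) - (\<Sum>n<N. Vlim G (replicate n h)))"
    by (intro tendsto_intros U_tendsto V_tendsto)
  have "norm (U (G + h) m - (\<Sum>n<N. V G m (replicate n h))) \<le> exp (2 * norm G) * 2 * (1 / 2) ^ N" for m
  proof -
    note sums = V_replicate_sums[OF h, of G m]
    have "(\<lambda>n. exp (2 * norm G) * (1 / 2) ^ N * (1 / 2 :: real) ^ n) sums (exp (2 * norm G) * (1 / 2) ^ N * 2)"
      using geometric_sums[of "1 / 2 :: real"] by (intro sums_mult) simp
    then have geo: "summable (\<lambda>n. exp (2 * norm G) * (1 / 2) ^ N * (1 / 2 :: real) ^ n)"
      "(\<Sum>n. exp (2 * norm G) * (1 / 2) ^ N * (1 / 2 :: real) ^ n) = exp (2 * norm G) * (1 / 2) ^ N * 2"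
      by (simp_all only: sums_iff)
    have "U (G + h) m - (\<Sum>n<N. V G m (replicate n h)) = (\<Sum>n. V G m (replicate (n + N) h))"
      using suminf_minus_initial_segment[OF sums_summable[OF sums], of N] sums_unique[OF sums] by simp
    also have "norm \<dots> \<le> exp (2 * norm G) * (1 / 2) ^ N * 2"
      unfolding geo(2)[symmetric]
    proof (rule norm_suminf_le[OF _ geo(1)])
      fix n
      show "norm (V G m (replicate (n + N) h)) \<le> exp (2 * norm G) * (1 / 2) ^ N * (1 / 2) ^ n"
        using norm_V_replicate_le[OF h, of G m "n + N"] by (simp add: power_add mult_ac)
    qed
    finally show ?thesis by (simp add: mult_ac)
  qed
  then show "\<exists>M. \<forall>m\<ge>M. norm (U (G + h) m - (\<Sum>n<N. V G m (replicate n h)))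
      \<le> exp (2 * norm G) * 2 * (1 / 2) ^ N" by blast
qed

lemma norm_Ulim_diff_le: 
  assumes "norm F \<le> R" "norm F' \<le> R"
  shows "norm (Ulim F - Ulim F') \<le> exp R * norm (F - F')"
proof -
  have loc: "norm (Ulim F - Ulim F') \<le> exp (norm F + norm (F - F')) * norm (F - F')" for F F'
  proof (rule LIMSEQ_le_const2)
    show "(\<lambda>m. norm (U F m - U F' m)) \<longlonglongrightarrow> norm (Ulim F - Ulim F')"
      by (intro tendsto_intros U_tendsto)
    show "\<exists>N. \<forall>m\<ge>N. norm (U F m - U F' m) \<le> exp (norm F + norm (F - F')) * norm (F - F')"
    proof (intro exI allI impI)
      fix m
      have "exp (csum m F + csum m (F - F')) * csum m (F - F') \<le> exp (norm F + norm (F - F')) * norm (F - F')"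
        using add_mono[OF csum_le_norm[of m F] csum_le_norm[of m "F - F'"]]
        by (intro mult_mono csum_le_norm csum_nonneg) auto
      with norm_U_diff_le show "norm (U F m - U F' m) \<le> exp (norm F + norm (F - F')) * norm (F - F')"
        by (rule order_trans)
    qed
  qed
  \<comment> \<open>For sequences at distance at most \<open>\<delta>\<close> the constant is
    \<open>exp (R + \<delta>)\<close>; subdivision extends it to the ball, and then
    \<open>\<delta>\<close> tends to 0.\<close>
  have "norm (Ulim F - Ulim F') \<le> exp (R + \<delta>) * norm (F - F')" if "\<delta> > 0" for \<delta>
  proof (rule lipschitz_on_ball_from_local[OF that _ assms])
    fix x y :: wiener assume "norm x \<le> R" "norm y \<le> R" "norm (x - y) \<le> \<delta>"
    then show "norm (Ulim x - Ulim y) \<le> exp (R + \<delta>) * norm (x - y)"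
      by (intro order_trans[OF loc] mult_right_mono) auto
  qed
  then have "\<forall>\<^sub>F \<delta> in at_right 0. norm (Ulim F - Ulim F') \<le> exp (R + \<delta>) * norm (F - F')"
    by (auto simp: eventually_at_filter)
  moreover have "((\<lambda>\<delta>. exp (R + \<delta>) * norm (F - F')) \<longlongrightarrow> exp (R + 0) * norm (F - F')) (at_right 0)"
    by (intro tendsto_intros)
  ultimately show ?thesis
    using tendsto_lowerbound[of _ _ "at_right (0 :: real)" "norm (Ulim F - Ulim F')"]
    by (simp only: trivial_limit_at_right_real add_0_right simp_thms)
qed

end

section \<open>The nonlinear Fourier series\<close>

text \<open>The elements of SU(2) with entries in the Wiener algebra are determined by their first row.
  The enumeration of the integers is such that the product of the first \<open>m\<close> factors extends over
  an interval: new factors are multiplied alternately from the right and from the left.\<close>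

definition rmul :: "int \<Rightarrow> complex \<Rightarrow> wiener \<times> wiener \<Rightarrow> wiener \<times> wiener" where
  "rmul k c v = (- mshift (- k) (cnj c) (snd v), mshift k c (fst v))"

text \<open>A left factor meets the second row of the matrix, which is
  \<open>(- wstar b, wstar a)\<close> for first row \<open>(a, b)\<close>; this is where the
  involution enters.\<close>

definition lmul :: "int \<Rightarrow> complex \<Rightarrow> wiener \<times> wiener \<Rightarrow> wiener \<times> wiener" where
  "lmul k c v = (- mshift k c (wstar (snd v)), mshift k c (wstar (fst v)))"

definition idx :: "nat \<Rightarrow> int" where
  "idx m = (if even m then int (m div 2) else - int (m div 2) - 1)"

definition offdiag :: "nat \<Rightarrow> complex \<Rightarrow> wiener \<times> wiener \<Rightarrow> wiener \<times> wiener" where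
  "offdiag m = (if even m then rmul (idx m) else lmul (idx m))"

lemma norm_fst_offdiag: "norm (fst (offdiag m c v)) = norm c * norm (snd v)"
  and norm_snd_offdiag: "norm (snd (offdiag m c v)) = norm c * norm (fst v)"
  by (auto simp: offdiag_def rmul_def lmul_def norm_mshift norm_wstar)

lemma norm_offdiag: "norm (offdiag m c v) = norm c * norm v"
proof -
  have "norm (offdiag m c v) = sqrt ((norm c)\<^sup>2 * ((norm (fst v))\<^sup>2 + (norm (snd v))\<^sup>2))"
    by (simp add: norm_prod_def norm_fst_offdiag norm_snd_offdiag power_mult_distrib algebra_simps)
  then show ?thesis by (simp add: real_sqrt_mult norm_prod_def)
qed

lemma bounded_bilinear_offdiag: "bounded_bilinear (offdiag m)"
proof
  show "\<exists>K. \<forall>a b. norm (offdiag m a b) \<le> norm a * norm b * K"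
    by (intro exI[of _ 1]) (simp add: norm_offdiag)
qed (auto simp: offdiag_def rmul_def lmul_def mshift_add_left mshift_add_right mshift_scaleR_left
      mshift_scaleR_right wstar_add wstar_scaleR complex_cnj_scaleR)

lemma norm_fst_prod_le: "norm (fst v) \<le> norm v"
  and norm_snd_prod_le: "norm (snd v) \<le> norm v"
  by (metis norm_fst_le prod.collapse, metis norm_snd_le prod.collapse)

lemma wstar_wone [simp]: "wstar wone = wone"
  by (rule wiener_eqI) (simp add: wstar.rep_eq wone.rep_eq)

text \<open>At first entry \<open>wone\<close> left and right multiplication agree in the second
  entry, so \<open>b\<close> linearizes at 0 to \<open>F\<close> itself.\<close>

lemma snd_offdiag_wone: "snd (offdiag m c (wone, b)) = mshift (idx m) c wone"
  by (simp add: offdiag_def rmul_def lmul_def)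

lemma idx_div2: "nat (if 0 \<le> idx m then 2 * idx m else - 2 * idx m - 1) = m"
  by (auto simp: idx_def elim!: evenE oddE)

lemma inj_idx: "inj idx"
  by (rule inj_on_inverseI[of _ "\<lambda>k. nat (if 0 \<le> k then 2 * k else - 2 * k - 1)"]) (rule idx_div2)

lemma idx_even: "idx (2 * m) = int m"
  and idx_odd: "idx (Suc (2 * m)) = - int m - 1"
  by (simp_all add: idx_def)

lemma surj_idx: "\<exists>m. idx m = k"
proof (cases "0 \<le> k")
  case True
  then show ?thesis using idx_even[of "nat k"] by auto
next
  case False
  then show ?thesis using idx_odd[of "nat (- k - 1)"] by (intro exI) auto
qed

interpretation nl: transfer_steps offdiag idx "(wone, 0)"
  by (rule transfer_steps.intro; (rule bounded_bilinear_offdiag inj_idx)?)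
     (simp_all add: norm_offdiag norm_wone norm_Pair)

lemma step_Pair: "nl.step m w v =
   (sfac w *\<^sub>R fst v + fst (offdiag m (bfac w) v), sfac w *\<^sub>R snd v + snd (offdiag m (bfac w) v))"
  by (simp add: nl.step_def prod_eq_iff)

subsection \<open>The linearization at zero\<close>

lemma norm_triangle4: "norm (a + b + c + d) \<le> norm a + norm b + norm c + norm d"
  for a b c d :: "'a::real_normed_vector"
  by (metis add_mono norm_triangle_ineq norm_triangle_le order_refl)

lemma norm_scaleR_sfac_le: "norm (sfac w *\<^sub>R v) \<le> norm v"
  using sfac_le_1[of w] sfac_pos[of w] by (simp add: mult_left_le_one_le)

text \<open>The constants close the induction: in
  \<open>3/4 S^2 + x^2/2 + 3/2 S x \<le> 3/4 (S + x)^2\<close> the mixed terms agree. The threshold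
  2/5 keeps the first entry below \<open>1 + 3/4 * 4/25 < 3/2\<close>.\<close>

lemma U_entries:
  assumes "nl.csum m F \<le> 2 / 5"
  shows "norm (snd (nl.U F m)) \<le> 3 / 2 * nl.csum m F"
    and "norm (fst (nl.U F m) - wone) \<le> 3 / 4 * (nl.csum m F)\<^sup>2"
    and "norm (fst (nl.U F m)) \<le> 3 / 2"
proof -
  have *: "norm (snd (nl.U F m)) \<le> 3 / 2 * nl.csum m F \<and>
      norm (fst (nl.U F m) - wone) \<le> 3 / 4 * (nl.csum m F)\<^sup>2 \<and> norm (fst (nl.U F m)) \<le> 3 / 2"
    using assms
  proof (induction m)
    case 0
    then show ?case by (simp add: norm_wone)
  next
    case (Suc m)
    define w x S v where "w = coeff F (idx m)" and "x = norm w" and "S = nl.csum m F" and "v = nl.U F m"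
    have x: "0 \<le> x" and S: "0 \<le> S" "nl.csum (Suc m) F = S + x"
      by (auto simp: x_def S_def w_def nl.csum_nonneg nl.csum_Suc)
    have IH: "norm (snd v) \<le> 3 / 2 * S" "norm (fst v - wone) \<le> 3 / 4 * S\<^sup>2" "norm (fst v) \<le> 3 / 2"
      using Suc x by (auto simp: S(2) S_def v_def)
    have beta: "norm (bfac w) \<le> x" by (simp add: x_def norm_bfac_le)
    have b: "norm (snd (nl.step m w v)) \<le> 3 / 2 * (S + x)"
    proof -
      have "norm (snd (nl.step m w v)) \<le> norm (snd v) + norm (bfac w) * norm (fst v)"
        using norm_triangle_ineq[of "sfac w *\<^sub>R snd v" "snd (offdiag m (bfac w) v)"] norm_scaleR_sfac_le[of w "snd v"]
        by (simp add: step_Pair norm_snd_offdiag)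
      also have "\<dots> \<le> 3 / 2 * S + x * (3 / 2)"
        by (intro add_mono mult_mono IH beta x) auto
      finally show ?thesis by simp
    qed
    have a: "norm (fst (nl.step m w v) - wone) \<le> 3 / 4 * (S + x)\<^sup>2"
    proof -
      have eq: "fst (nl.step m w v) - wone = sfac w *\<^sub>R (fst v - wone) + (sfac w - 1) *\<^sub>R wone + fst (offdiag m (bfac w) v)"
        by (simp add: step_Pair algebra_simps)
      have "norm (fst (nl.step m w v) - wone)
         \<le> norm (fst v - wone) + \<bar>sfac w - 1\<bar> + norm (bfac w) * norm (snd v)"
        unfolding eq using norm_scaleR_sfac_le[of w "fst v - wone"]
        by (intro order_trans[OF norm_triangle_ineq] add_mono) (auto simp: norm_fst_offdiag norm_wone)
      also have "\<dots> \<le> 3 / 4 * S\<^sup>2 + x\<^sup>2 / 2 + x * (3 / 2 * S)"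
        using sfac_le_1[of w] one_minus_sfac_le[of w]
        by (intro add_mono mult_mono IH beta x) (auto simp: x_def)
      also have "\<dots> \<le> 3 / 4 * (S + x)\<^sup>2"
        by (simp add: power2_eq_square algebra_simps)
      finally show ?thesis .
    qed
    have "(S + x)\<^sup>2 \<le> (2 / 5)\<^sup>2"
      using Suc.prems x S by (intro power_mono) auto
    then have "norm (fst (nl.step m w v)) \<le> 3 / 2"
      using a norm_triangle_ineq[of "fst (nl.step m w v) - wone" wone]
      by (simp add: norm_wone power2_eq_square)
    with a b show ?case
      by (simp add: S(2)) (simp add: v_def w_def)
  qed
  then show "norm (snd (nl.U F m)) \<le> 3 / 2 * nl.csum m F"
    and "norm (fst (nl.U F m) - wone) \<le> 3 / 4 * (nl.csum m F)\<^sup>2"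
    and "norm (fst (nl.U F m)) \<le> 3 / 2" by auto
qed

text \<open>The linear part of the second entry of \<open>U F m\<close>.\<close>

definition trunc :: "wiener \<Rightarrow> nat \<Rightarrow> wiener" where
  "trunc F m = (\<Sum>j<m. mshift (idx j) (coeff F (idx j)) wone)"

lemma norm_trunc_le: "norm (trunc F m) \<le> nl.csum m F"
  unfolding trunc_def nl.csum_def by (rule sum_norm_le) (simp add: norm_mshift norm_wone)

lemma coeff_sum: "coeff (sum f A) k = (\<Sum>x\<in>A. coeff (f x) k)"
  by (induction A rule: infinite_finite_induct) auto

lemma trunc_tendsto: "trunc F \<longlonglongrightarrow> F"
proof -
  define g where "g j = mshift (idx j) (coeff F (idx j)) wone" for j
  have "summable g"
  proof (rule summable_norm_cancel, rule bounded_imp_summable)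
    fix N
    have "(\<Sum>j\<le>N. norm (g j)) = nl.csum (Suc N) F"
      unfolding nl.csum_def lessThan_Suc_atMost by (simp add: g_def norm_mshift norm_wone)
    then show "(\<Sum>j\<le>N. norm (g j)) \<le> norm F"
      using nl.csum_le_norm by simp
  qed simp
  then have s: "g sums suminf g" by (rule summable_sums)
  have "suminf g = F"
  proof (rule wiener_eqI)
    fix k
    obtain m where m: "idx m = k" using surj_idx by blast
    have "(\<lambda>j. coeff (g j) k) = (\<lambda>j. if j = m then coeff F k else 0)"
      using m injD[OF inj_idx] by (auto simp: g_def mshift.rep_eq wone.rep_eq fun_eq_iff)
    then have "(\<lambda>j. coeff (g j) k) sums coeff F k"
      using sums_single[of m "\<lambda>_. coeff F k"] by simp
    moreover have "(\<lambda>j. coeff (g j) k) sums coeff (suminf g) k"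
      by (rule bounded_linear.sums[OF bounded_linear_coeff s])
    ultimately show "coeff (suminf g) k = coeff F k"
      by (rule sums_unique2[symmetric])
  qed
  moreover have "trunc F = (\<lambda>n. sum g {..<n})"
    by (simp add: fun_eq_iff trunc_def g_def)
  ultimately show ?thesis using s by (simp add: sums_def)
qed

text \<open>The two estimates are proved together, since each step feeds the difference of either
  entry into the other. The first entry varies at order \<open>S D\<close>; the second deviates from
  its linear part only at order \<open>S^2 D\<close>.\<close>

lemma U_diff_entries:
  assumes "nl.csum m F + nl.csum m (F - F') \<le> 2 / 5"
  shows "norm (fst (nl.U F m - nl.U F' m))
       \<le> 3 / 2 * (nl.csum m F + nl.csum m (F - F')) * nl.csum m (F - F')"
    and "norm (snd (nl.U F m - nl.U F' m) - trunc (F - F') m)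
       \<le> 9 / 4 * (nl.csum m F + nl.csum m (F - F'))\<^sup>2 * nl.csum m (F - F')"
proof -
  have "norm (fst (nl.U F m - nl.U F' m))
       \<le> 3 / 2 * (nl.csum m F + nl.csum m (F - F')) * nl.csum m (F - F') \<and>
     norm (snd (nl.U F m - nl.U F' m) - trunc (F - F') m)
       \<le> 9 / 4 * (nl.csum m F + nl.csum m (F - F'))\<^sup>2 * nl.csum m (F - F')"
    using assms
  proof (induction m)
    case 0
    then show ?case by (simp add: trunc_def)
  next
    case (Suc m)
    define w w' where "w = coeff F (idx m)" and "w' = coeff F' (idx m)"
    define \<delta> d where "\<delta> = norm (w - w')" and "d = norm w + \<delta>"
    define S D where "S = nl.csum m F + nl.csum m (F - F')" and "D = nl.csum m (F - F')"
    define v v' where "v = nl.U F m" and "v' = nl.U F' m"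
    define T where "T = trunc (F - F') m"
    have nonneg: "0 \<le> \<delta>" "0 \<le> d" "0 \<le> D" "0 \<le> S"
      by (auto simp: \<delta>_def d_def D_def S_def nl.csum_nonneg)
    have SD': "nl.csum (Suc m) F + nl.csum (Suc m) (F - F') = S + d" "nl.csum (Suc m) (F - F') = D + \<delta>"
      by (auto simp: S_def D_def d_def \<delta>_def w_def w'_def nl.csum_Suc)
    have S: "S \<le> 2 / 5" using Suc.prems SD'(1) nonneg by linarith
    have max: "max (norm w) (norm w') \<le> d" "norm w \<le> d"
      using norm_triangle_sub[of w' w] by (auto simp: d_def \<delta>_def norm_minus_commute)
    have S': "nl.csum m F' \<le> S"
      unfolding S_def nl.csum_def sum.distrib[symmetric]
      by (rule sum_mono) (use norm_triangle_sub norm_minus_commute in \<open>metis minus_wiener.rep_eq\<close>)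
    have v': "norm (snd v') \<le> 3 / 2 * S" "norm (fst v' - wone) \<le> 3 / 4 * S\<^sup>2" "norm (fst v') \<le> 3 / 2"
      using U_entries[of m F'] S S' power_mono[OF S' nl.csum_nonneg, of 2] by (auto simp: v'_def)
    have IH: "norm (fst v - fst v') \<le> 3 / 2 * S * D" "norm (snd v - snd v' - T) \<le> 9 / 4 * S\<^sup>2 * D"
      using Suc.IH S by (auto simp: S_def D_def v_def v'_def T_def)
    have T: "norm T \<le> D"
      using norm_trunc_le by (simp add: T_def D_def)
    have S2: "S\<^sup>2 \<le> 4 / 25"
      using power_mono[OF S nonneg(4), of 2] by (simp add: power2_eq_square)
    have db: "norm (snd v - snd v') \<le> 3 / 2 * D"
    proof -
      have "norm (snd v - snd v') \<le> norm (snd v - snd v' - T) + norm T"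
        by (metis diff_add_cancel norm_triangle_ineq)
      also have "\<dots> \<le> 9 / 4 * S\<^sup>2 * D + D" using IH T by simp
      \<comment> \<open>\<open>9/4 S^2\<close> is at most \<open>9/25 < 1/2\<close>.\<close>
      also have "\<dots> \<le> 3 / 2 * D"
        using mult_right_mono[OF S2 nonneg(3)] nonneg(3) by linarith
      finally show ?thesis .
    qed
    have ds: "\<bar>sfac w - sfac w'\<bar> \<le> d * \<delta>"
      using sfac_diff_le[of w w'] mult_right_mono[OF max(1) nonneg(1)] by (simp add: \<delta>_def)
    have dbf: "norm (bfac w - bfac w') \<le> \<delta>"
      by (simp add: \<delta>_def norm_bfac_diff_le)
    have ddbf: "norm (bfac w - bfac w' - (w - w')) \<le> 3 / 2 * d\<^sup>2 * \<delta>"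
    proof (rule order_trans[OF norm_bfac_diff_diff_le])
      show "3 / 2 * (max (norm w) (norm w'))\<^sup>2 * norm (w - w') \<le> 3 / 2 * d\<^sup>2 * \<delta>"
        unfolding \<delta>_def by (intro mult_right_mono mult_left_mono power_mono max) (auto simp: le_max_iff_disj)
    qed
    have bw: "norm (bfac w) \<le> d"
      using norm_bfac_le[of w] max by simp
    have s1: "\<bar>sfac w - 1\<bar> \<le> d\<^sup>2 / 2"
      using sfac_le_1[of w] one_minus_sfac_le[of w] power_mono[OF max(2), of 2] by simp
    note lin = nl.B_simps(3,4,1)
    have a: "norm (fst (nl.step m w v - nl.step m w' v')) \<le> 3 / 2 * (S + d) * (D + \<delta>)"
    proof -
      have eq: "fst (nl.step m w v - nl.step m w' v') =
          sfac w *\<^sub>R (fst v - fst v') + (sfac w - sfac w') *\<^sub>R fst v'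
          + fst (offdiag m (bfac w) (v - v')) + fst (offdiag m (bfac w - bfac w') v')"
        by (simp add: step_Pair lin algebra_simps)
      have "norm (fst (nl.step m w v - nl.step m w' v')) \<le>
          norm (fst v - fst v') + \<bar>sfac w - sfac w'\<bar> * norm (fst v')
          + norm (bfac w) * norm (snd v - snd v') + norm (bfac w - bfac w') * norm (snd v')"
        unfolding eq using norm_scaleR_sfac_le[of w "fst v - fst v'"]
        by (intro order_trans[OF norm_triangle4] add_mono) (auto simp: norm_fst_offdiag)
      \<comment> \<open>The four terms are exactly the expansion of the target product.\<close>
      also have "\<dots> \<le> 3 / 2 * S * D + (d * \<delta>) * (3 / 2) + d * (3 / 2 * D) + \<delta> * (3 / 2 * S)"
        by (intro add_mono mult_mono IH ds v' bw db dbf nonneg mult_nonneg_nonneg) auto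
      also have "\<dots> = 3 / 2 * (S + d) * (D + \<delta>)"
        by (simp add: algebra_simps)
      finally show ?thesis .
    qed
    have b: "norm (snd (nl.step m w v - nl.step m w' v') - (T + mshift (idx m) (w - w') wone))
        \<le> 9 / 4 * (S + d)\<^sup>2 * (D + \<delta>)"
    proof -
      have one: "snd (offdiag m (w - w') (wone, 0)) = mshift (idx m) (w - w') wone"
        by (rule snd_offdiag_wone)
      have "snd (offdiag m (w - w') (v' - (wone, 0))) = snd (offdiag m (w - w') v') - mshift (idx m) (w - w') wone"
        unfolding lin(2) by (simp add: one)
      \<comment> \<open>The first-order part of the new coefficient acting on the identity row
        \<open>(wone, 0)\<close> is the new term of \<open>trunc\<close>; every remaining term is of
        higher order.\<close>
      then have eq: "snd (nl.step m w v - nl.step m w' v') - (T + mshift (idx m) (w - w') wone) =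
          (sfac w *\<^sub>R (snd v - snd v' - T) + (sfac w - 1) *\<^sub>R T + (sfac w - sfac w') *\<^sub>R snd v'
            + snd (offdiag m (bfac w) (v - v')))
          + (snd (offdiag m (bfac w - bfac w' - (w - w')) v')
            + snd (offdiag m (w - w') (v' - (wone, 0))))"
        by (simp add: step_Pair lin algebra_simps)
      have "norm (snd (nl.step m w v - nl.step m w' v') - (T + mshift (idx m) (w - w') wone)) \<le>
          (norm (snd v - snd v' - T) + \<bar>sfac w - 1\<bar> * norm T + \<bar>sfac w - sfac w'\<bar> * norm (snd v')
           + norm (bfac w) * norm (fst v - fst v'))
          + (norm (bfac w - bfac w' - (w - w')) * norm (fst v') + \<delta> * norm (fst v' - wone))"
        unfolding eq using norm_scaleR_sfac_le[of w "snd v - snd v' - T"]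
        by (intro order_trans[OF norm_triangle_ineq] add_mono order_trans[OF norm_triangle4])
           (auto simp: norm_snd_offdiag \<delta>_def)
      also have "\<dots> \<le> (9 / 4 * S\<^sup>2 * D + d\<^sup>2 / 2 * D + (d * \<delta>) * (3 / 2 * S) + d * (3 / 2 * S * D))
          + (3 / 2 * d\<^sup>2 * \<delta> * (3 / 2) + \<delta> * (3 / 4 * S\<^sup>2))"
        by (intro add_mono mult_mono IH ds v' bw T s1 ddbf nonneg mult_nonneg_nonneg) (auto simp: nonneg)
      also have "\<dots> \<le> 9 / 4 * (S + d)\<^sup>2 * (D + \<delta>)"
      proof -
        \<comment> \<open>The excess of the target is a combination of monomials with nonnegative
          coefficients.\<close>
        have "9 / 4 * (S + d)\<^sup>2 * (D + \<delta>) - ((9 / 4 * S\<^sup>2 * D + d\<^sup>2 / 2 * D + (d * \<delta>) * (3 / 2 * S) + d * (3 / 2 * S * D))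
          + (3 / 2 * d\<^sup>2 * \<delta> * (3 / 2) + \<delta> * (3 / 4 * S\<^sup>2)))
          = 3 * (S * d * D) + 7 / 4 * (d\<^sup>2 * D) + 3 / 2 * (S\<^sup>2 * \<delta>) + 3 * (S * d * \<delta>)"
          by (simp add: power2_eq_square field_simps)
        also have "\<dots> \<ge> 0"
          using nonneg by simp
        finally show ?thesis by simp
      qed
      finally show ?thesis .
    qed
    show ?case
      using a b unfolding SD'(1) unfolding SD'(2) by (simp add: trunc_def T_def w_def w'_def v_def v'_def)
  qed
  then show "norm (fst (nl.U F m - nl.U F' m))
       \<le> 3 / 2 * (nl.csum m F + nl.csum m (F - F')) * nl.csum m (F - F')"
    and "norm (snd (nl.U F m - nl.U F' m) - trunc (F - F') m)
       \<le> 9 / 4 * (nl.csum m F + nl.csum m (F - F'))\<^sup>2 * nl.csum m (F - F')" by auto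
qed

lemma norm_diff_le_snd_Ulim:
  assumes R: "R \<le> 9 / 25" and F: "norm F \<le> R" and F': "norm F' \<le> R"
  shows "norm (F - F') \<le> 2 * norm (snd (nl.Ulim F) - snd (nl.Ulim F'))"
proof -
  have "norm ((snd (nl.Ulim F) - F) - (snd (nl.Ulim F') - F')) \<le> 1 / 2 * norm (F - F')"
  \<comment> \<open>The step length 1/25 fits \<open>9/25 + 1/25 = 2/5\<close>, the threshold of
    \<open>U_diff_entries\<close>; there \<open>9/4 * (2/5)^2 = 9/25\<close> is below 1/2.\<close>
  proof (rule lipschitz_on_ball_from_local[of "1 / 25" R "\<lambda>F. snd (nl.Ulim F) - F"])
    fix F F' :: wiener
    assume *: "norm F \<le> R" "norm F' \<le> R" "norm (F - F') \<le> 1 / 25"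
    have "(\<lambda>m. norm (snd (nl.U F m - nl.U F' m) - trunc (F - F') m))
        \<longlonglongrightarrow> norm (snd (nl.Ulim F - nl.Ulim F') - (F - F'))"
      by (intro tendsto_intros nl.U_tendsto trunc_tendsto)
    moreover have "norm (snd (nl.U F m - nl.U F' m) - trunc (F - F') m) \<le> 1 / 2 * norm (F - F')" for m
    proof -
      define S where "S = nl.csum m F + nl.csum m (F - F')"
      have S: "0 \<le> S" "S \<le> 2 / 5"
        using nl.csum_le_norm[of m F] nl.csum_le_norm[of m "F - F'"] * R by (auto simp: S_def nl.csum_nonneg)
      have "S\<^sup>2 \<le> (2 / 5)\<^sup>2" using S by (intro power_mono) auto
      then have "9 / 4 * S\<^sup>2 \<le> 1 / 2" by (simp add: power2_eq_square)
      then have "9 / 4 * S\<^sup>2 * nl.csum m (F - F') \<le> 1 / 2 * norm (F - F')"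
        by (intro mult_mono nl.csum_le_norm nl.csum_nonneg) auto
      with U_diff_entries(2)[of m F F'] S show ?thesis
        unfolding S_def by linarith
    qed
    ultimately have "norm (snd (nl.Ulim F - nl.Ulim F') - (F - F')) \<le> 1 / 2 * norm (F - F')"
      by (intro LIMSEQ_le_const2) auto
    then show "norm ((snd (nl.Ulim F) - F) - (snd (nl.Ulim F') - F')) \<le> 1 / 2 * norm (F - F')"
      by (simp add: algebra_simps)
  qed (use F F' in auto)
  moreover have "norm (F - F') \<le> norm (snd (nl.Ulim F) - snd (nl.Ulim F'))
      + norm ((snd (nl.Ulim F) - F) - (snd (nl.Ulim F') - F'))"
    by (rule order_trans[OF _ norm_triangle_ineq4]) (simp add: algebra_simps)
  ultimately show ?thesis by linarith
qed

subsection \<open>Evaluation on the circle\<close>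

definition weval :: "wiener \<Rightarrow> complex \<Rightarrow> complex" where
  "weval f z = wiener_eval (coeff f) z"

context
  fixes z :: complex
  assumes z: "norm z = 1"
begin

lemma z_nonzero: "z \<noteq> 0"
  using z by auto

lemma weval_summable: "(\<lambda>n. coeff f n * z powi n) summable_on UNIV"
  by (rule abs_summable_summable) (simp add: norm_mult norm_power_int z coeff_summable)

lemma weval_add: "weval (f + g) z = weval f z + weval g z"
  using infsum_add[OF weval_summable weval_summable]
  by (simp add: weval_def wiener_eval_def distrib_right)

lemma weval_scaleR: "weval (c *\<^sub>R f) z = of_real c * weval f z"
  by (simp add: weval_def wiener_eval_def infsum_cmult_right' scaleR_conv_of_real mult.assoc)

lemma weval_minus: "weval (- f) z = - weval f z"
  using weval_scaleR[of "- 1" f] by simp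

lemma weval_0: "weval 0 z = 0"
  by (simp add: weval_def wiener_eval_def)

lemma weval_wone: "weval wone z = 1"
proof -
  have "weval wone z = (\<Sum>\<^sub>\<infinity>n\<in>{0}. coeff wone n * z powi n)"
    unfolding weval_def wiener_eval_def by (rule infsum_cong_neutral) (auto simp: wone.rep_eq)
  then show ?thesis by (simp add: wone.rep_eq)
qed

lemma weval_mshift: "weval (mshift k c f) z = c * z powi k * weval f z"
proof -
  have "weval (mshift k c f) z = (\<Sum>\<^sub>\<infinity>n. c * z powi k * (coeff f (n - k) * z powi (n - k)))"
    unfolding weval_def wiener_eval_def
    by (rule infsum_cong) (simp add: mshift.rep_eq power_int_diff z_nonzero)
  also have "\<dots> = c * z powi k * (\<Sum>\<^sub>\<infinity>n. coeff f (n - k) * z powi (n - k))"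
    by (rule infsum_cmult_right')
  also have "(\<Sum>\<^sub>\<infinity>n. coeff f (n - k) * z powi (n - k)) = (\<Sum>\<^sub>\<infinity>n. coeff f n * z powi n)"
    by (rule infsum_reindex_bij_betw) (auto intro!: bij_betwI[where g = "\<lambda>n. n + k"])
  finally show ?thesis by (simp add: weval_def wiener_eval_def)
qed

lemma cnj_powi: "cnj z powi k = z powi (- k)"
proof -
  have "z * cnj z = 1"
    using complex_norm_square[of z] z by simp
  then have "cnj z = inverse z"
    by (rule inverse_unique[symmetric])
  then show ?thesis
    by (simp add: power_int_inverse power_int_minus)
qed

lemma weval_wstar: "weval (wstar f) z = cnj (weval f z)"
proof -
  have "weval (wstar f) z = (\<Sum>\<^sub>\<infinity>n. cnj (coeff f (- n) * z powi (- n)))"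
    unfolding weval_def wiener_eval_def by (simp add: wstar.rep_eq cnj_powi)
  also have "\<dots> = cnj (\<Sum>\<^sub>\<infinity>n. coeff f (- n) * z powi (- n))"
    by (rule infsum_cnj)
  also have "(\<Sum>\<^sub>\<infinity>n. coeff f (- n) * z powi (- n)) = (\<Sum>\<^sub>\<infinity>n. coeff f n * z powi n)"
    by (rule infsum_reindex_bij_betw) (auto intro!: bij_betwI[where g = uminus])
  finally show ?thesis by (simp add: weval_def wiener_eval_def)
qed

text \<open>The full matrix at \<open>z\<close>, its second row recovered from the first as in
  SU(2).\<close>

definition meval :: "wiener \<times> wiener \<Rightarrow> mat2" where
  "meval v = (weval (fst v) z, weval (snd v) z, - cnj (weval (snd v) z), cnj (weval (fst v) z))"

lemma meval_step:
  "meval (nl.step m (F (idx m)) v) =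
     (if even m then mat2_mult (meval v) (nlft_factor F (idx m) z)
      else mat2_mult (nlft_factor F (idx m) z) (meval v))"
  by (simp add: meval_def step_Pair offdiag_def rmul_def lmul_def mat2_mult_def nlft_factor_def
      weval_add weval_scaleR weval_minus weval_mshift weval_wstar Let_def sfac_def[symmetric]
      bfac_def cnj_powi algebra_simps)

lemma mat2_mult_assoc: "mat2_mult (mat2_mult L M) N = mat2_mult L (mat2_mult M N)"
  by (cases L; cases M; cases N) (simp add: mat2_mult_def algebra_simps)

lemma mat2_mult_id: "mat2_mult M mat2_id = M" "mat2_mult mat2_id M = M"
  by (cases M; simp add: mat2_mult_def mat2_id_def)+

lemma foldl_mat2_mult:
  "mat2_mult L (foldl (\<lambda>M k. mat2_mult M (f k)) N ks) = foldl (\<lambda>M k. mat2_mult M (f k)) (mat2_mult L N) ks"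
  by (induction ks arbitrary: N) (simp_all add: mat2_mult_assoc)

text \<open>Step \<open>2 m\<close> appends index \<open>m\<close> on the right and step
  \<open>2 m + 1\<close> prepends index \<open>-m - 1\<close> on the left, so the interval grows by
  one at each end.\<close>

lemma meval_U: "meval (nl.U F (2 * m)) = nlft_prod (coeff F) (- int m) (int m - 1) z"
proof (induction m)
  case 0
  then show ?case
    by (simp add: meval_def weval_wone weval_0 nlft_prod_def mat2_id_def)
next
  case (Suc m)
  let ?f = "\<lambda>M k. mat2_mult M (nlft_factor (coeff F) k z)"
  have "[- int (Suc m)..int (Suc m) - 1] = (- int m - 1) # [- int m..int m - 1] @ [int m]"
    using upto_rec1[of "- int (Suc m)" "int m"] upto_rec2[of "- int m" "int m"] by simp
  then have "nlft_prod (coeff F) (- int (Suc m)) (int (Suc m) - 1) z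
      = mat2_mult (nlft_factor (coeff F) (- int m - 1) z) (mat2_mult (foldl ?f mat2_id [- int m..int m - 1])
          (nlft_factor (coeff F) (int m) z))"
    by (simp add: nlft_prod_def mat2_mult_id foldl_mat2_mult mat2_mult_assoc[symmetric])
  then show ?case
    using Suc.IH meval_step[where m = "2 * m" and F = "coeff F" and v = "nl.U F (2 * m)"]
      meval_step[where m = "Suc (2 * m)" and F = "coeff F" and v = "nl.U F (Suc (2 * m))"]
    by (simp add: idx_even idx_odd nlft_prod_def)
qed

section \<open>Agreement with the finite product for finitely supported sequences\<close>

lemma nlft_factor_trivial: "F k = 0 \<Longrightarrow> nlft_factor F k z = mat2_id"
  by (simp add: nlft_factor_def mat2_id_def)

lemma nlft_prod_filter:
  "nlft_prod F lo hi z = foldl (\<lambda>M k. mat2_mult M (nlft_factor F k z)) mat2_id (filter (\<lambda>k. F k \<noteq> 0) [lo..hi])"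
proof -
  have "foldl (\<lambda>M k. mat2_mult M (nlft_factor F k z)) N ks
      = foldl (\<lambda>M k. mat2_mult M (nlft_factor F k z)) N (filter (\<lambda>k. F k \<noteq> 0) ks)" for N ks
    by (induction ks arbitrary: N) (simp_all add: nlft_factor_trivial mat2_mult_id)
  then show ?thesis by (simp add: nlft_prod_def)
qed

text \<open>Vanishing coefficients give identity factors, so the product depends only on the sorted
  list of the support.\<close>

lemma nlft_prod_cong_support:
  assumes "{k. F k \<noteq> 0} \<subseteq> {lo..hi}" "{k. F k \<noteq> 0} \<subseteq> {lo'..hi'}"
  shows "nlft_prod F lo hi z = nlft_prod F lo' hi' z"
proof -
  have "filter (\<lambda>k. F k \<noteq> 0) [lo..hi] = filter (\<lambda>k. F k \<noteq> 0) [lo'..hi']"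
    by (rule sorted_distinct_set_unique) (use assms in \<open>auto intro!: sorted_wrt_filter\<close>)
  then show ?thesis by (simp add: nlft_prod_filter)
qed

lemma meval_Ulim:
  assumes supp: "{k. coeff F k \<noteq> 0} \<subseteq> {lo..hi}"
  shows "meval (nl.Ulim F) = nlft_prod (coeff F) lo hi z"
proof -
  \<comment> \<open>The added 1 ensures \<open>hi \<le> m - 1\<close>, since the first
    \<open>2 m\<close> factors cover \<open>-m\<close> to \<open>m - 1\<close>. From there on
    \<open>U F\<close> is constant.\<close>
  define m where "m = nat (max \<bar>lo\<bar> \<bar>hi\<bar>) + 1"
  have m: "- int m \<le> lo" "hi \<le> int m - 1" by (auto simp: m_def)
  have "nl.U F (2 * m + n) = nl.U F (2 * m)" for n
  proof (induction n)
    case (Suc n)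
    have "coeff F (idx (2 * m + n)) = 0"
    proof (rule ccontr)
      assume "coeff F (idx (2 * m + n)) \<noteq> 0"
      then have "- int m \<le> idx (2 * m + n)" "idx (2 * m + n) \<le> int m - 1"
        using supp m by force+
      then show False by (auto simp: idx_def split: if_splits)
    qed
    with Suc show ?case by simp
  qed simp
  then have "(\<lambda>n. nl.U F (n + 2 * m)) = (\<lambda>n. nl.U F (2 * m))"
    by (simp add: add.commute)
  then have "(\<lambda>n. nl.U F (2 * m)) \<longlonglongrightarrow> nl.Ulim F"
    using LIMSEQ_ignore_initial_segment[OF nl.U_tendsto[of F], of "2 * m"] by simp
  then have "nl.Ulim F = nl.U F (2 * m)"
    using LIMSEQ_unique tendsto_const by blast
  moreover have "{k. coeff F k \<noteq> 0} \<subseteq> {- int m..int m - 1}"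
    using supp m by force
  ultimately show ?thesis
    using nlft_prod_cong_support[OF supp] by (simp add: meval_U)
qed

end

subsection \<open>Analyticity and the main theorem\<close>

text \<open>For \<open>F\<close> outside \<open>l1\<close> the value \<open>Wiener F\<close> is
  unspecified; finitely supported sequences are in \<open>l1\<close>.\<close>

definition nlft :: "seq \<Rightarrow> seq \<times> seq" where
  "nlft F = (coeff (fst (nl.Ulim (Wiener F))), coeff (snd (nl.Ulim (Wiener F))))"

section \<open>Translation between sequences and elements of the Banach space\<close>

lemma Wiener_sadd: "f \<in> l1 \<Longrightarrow> g \<in> l1 \<Longrightarrow> Wiener (sadd f g) = Wiener f + Wiener g"
proof -
  assume *: "f \<in> l1" "g \<in> l1"
  have "sadd f g = coeff (Wiener f + Wiener g)"
    by (simp add: sadd_def fun_eq_iff Wiener_inverse *)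
  then show ?thesis by (simp only: coeff_inverse)
qed

lemma Wiener_sscale: "f \<in> l1 \<Longrightarrow> Wiener (sscale c f) = c *\<^sub>R Wiener f"
proof -
  assume *: "f \<in> l1"
  have "sscale c f = coeff (c *\<^sub>R Wiener f)"
    by (simp add: sscale_def fun_eq_iff Wiener_inverse * scaleR_conv_of_real)
  then show ?thesis by (simp only: coeff_inverse)
qed

lemma sdiff_coeff: "sdiff (coeff f) (coeff g) = coeff (f - g)"
  by (simp add: sdiff_def fun_eq_iff)

lemma l1_norm_sdiff_coeff: "l1_norm (sdiff (coeff f) (coeff g)) = norm (f - g)"
  by (simp only: sdiff_coeff norm_eq_l1_norm)

lemma l1_norm_Wiener: "f \<in> l1 \<Longrightarrow> l1_norm f = norm (Wiener f)"
  by (simp add: norm_eq_l1_norm Wiener_inverse)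

lemma real_analytic_nlft: "real_analytic_l1_A2 nlft"
  unfolding real_analytic_l1_A2_def
proof
  fix x0 assume x0: "x0 \<in> l1"
  define G where "G = Wiener x0"
  define A :: "nat \<Rightarrow> seq list \<Rightarrow> seq \<times> seq" where
    "A n hs = (coeff (fst (nl.Vlim G (map Wiener hs))), coeff (snd (nl.Vlim G (map Wiener hs))))" for n hs
  \<comment> \<open>The factor 2 arises because \<open>A2_norm\<close> adds the norms of the
    entries, each of which is at most the Euclidean product norm.\<close>
  define C :: "nat \<Rightarrow> real" where "C n = 2 * exp (2 * norm G) * 5 ^ n" for n
  have "real_multilinear n (A n)" for n
    unfolding real_multilinear_def
  proof (intro conjI allI impI; elim conjE)
    fix hs :: "seq list" and i u v
    assume *: "length hs = n" "i < n" "u \<in> l1" "v \<in> l1"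
    then have "linear (\<lambda>u. nl.Vlim G ((map Wiener hs)[i := u]))"
      using nl.multilin_Vlim by (auto simp: multilin_def)
    from linear_add[OF this, of "Wiener u" "Wiener v"] *
    show "A n (hs[i := sadd u v]) = padd (A n (hs[i := u])) (A n (hs[i := v]))"
      by (simp add: A_def padd_def map_update Wiener_sadd) (simp add: sadd_def fun_eq_iff)
  next
    fix hs :: "seq list" and i u and c :: real
    assume *: "length hs = n" "i < n" "u \<in> l1"
    then have "linear (\<lambda>u. nl.Vlim G ((map Wiener hs)[i := u]))"
      using nl.multilin_Vlim by (auto simp: multilin_def)
    from linear_scale[OF this, of c "Wiener u"] *
    show "A n (hs[i := sscale c u]) = pscale c (A n (hs[i := u]))"
      by (simp add: A_def pscale_def map_update Wiener_sscale)
        (simp add: sscale_def fun_eq_iff scaleR_conv_of_real)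
  qed
  moreover have "multilinear_bounded n (A n) (C n)" for n
    unfolding multilinear_bounded_def
  proof (intro allI impI; elim conjE)
    fix hs :: "seq list" assume *: "length hs = n" "set hs \<subseteq> l1"
    define v where "v = nl.Vlim G (map Wiener hs)"
    have prod: "(\<Prod>h\<leftarrow>map Wiener hs. norm h) = (\<Prod>h\<leftarrow>hs. l1_norm h)"
      using *(2) by (induction hs) (auto simp: l1_norm_Wiener)
    have "A2_norm (A n hs) = norm (fst v) + norm (snd v)"
      by (simp add: A2_norm_def A_def v_def norm_eq_l1_norm)
    also have "\<dots> \<le> 2 * norm v"
      using norm_fst_prod_le[of v] norm_snd_prod_le[of v] by simp
    also have "\<dots> \<le> C n * (\<Prod>h\<leftarrow>hs. l1_norm h)"
      using nl.norm_Vlim_le[of G "map Wiener hs"] *(1) unfolding prod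
      by (simp add: v_def C_def mult.assoc)
    finally show "A n hs \<in> A2 \<and> A2_norm (A n hs) \<le> C n * (\<Prod>h\<leftarrow>hs. l1_norm h)"
      by (simp add: A_def A2_def coeff)
  qed
  \<comment> \<open>At radius 1/10 the terms are geometric with ratio \<open>5/10\<close>.\<close>
  moreover have "summable (\<lambda>n. C n * (1 / 10) ^ n)"
  proof -
    have "(\<lambda>n. C n * (1 / 10) ^ n) = (\<lambda>n. 2 * exp (2 * norm G) * (1 / 2) ^ n)"
      by (simp add: C_def fun_eq_iff mult.assoc power_mult_distrib[symmetric])
    then show ?thesis by (simp add: summable_mult summable_geometric)
  qed
  moreover have "(\<lambda>N. A2_norm (pdiff (nlft (sadd x0 h)) (psum (\<lambda>n. A n (replicate n h)) N))) \<longlonglongrightarrow> 0"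
    if h: "h \<in> l1" "l1_norm h < 1 / 10" for h
  proof (rule Lim_null_comparison)
    define d where "d N = nl.Ulim (G + Wiener h) - (\<Sum>n<N. nl.Vlim G (replicate n (Wiener h)))" for N
    have eq: "A2_norm (pdiff (nlft (sadd x0 h)) (psum (\<lambda>n. A n (replicate n h)) N)) = norm (fst (d N)) + norm (snd (d N))" for N
    proof -
      have "psum (\<lambda>n. A n (replicate n h)) N =
        (coeff (fst (\<Sum>n<N. nl.Vlim G (replicate n (Wiener h)))), coeff (snd (\<Sum>n<N. nl.Vlim G (replicate n (Wiener h)))))"
        by (simp add: psum_def A_def fst_sum snd_sum coeff_sum fun_eq_iff)
      then show ?thesis
        by (simp add: A2_norm_def pdiff_def nlft_def Wiener_sadd x0 h l1_norm_sdiff_coeff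
            d_def G_def)
    qed
    have le: "norm (fst (d N)) + norm (snd (d N)) \<le> 2 * norm (d N)" for N
      using norm_fst_prod_le[of "d N"] norm_snd_prod_le[of "d N"] by simp
    have d: "norm (d N) \<le> exp (2 * norm G) * 2 * (1 / 2) ^ N" for N
      unfolding d_def by (rule nl.norm_Ulim_minus_Vlim_le) (use h in \<open>simp add: l1_norm_Wiener\<close>)
    show "\<forall>\<^sub>F N in sequentially.
       norm (A2_norm (pdiff (nlft (sadd x0 h)) (psum (\<lambda>n. A n (replicate n h)) N)))
         \<le> 2 * (exp (2 * norm G) * 2 * (1 / 2) ^ N)"
    proof (intro always_eventually allI)
      fix N
      show "norm (A2_norm (pdiff (nlft (sadd x0 h)) (psum (\<lambda>n. A n (replicate n h)) N)))
         \<le> 2 * (exp (2 * norm G) * 2 * (1 / 2) ^ N)"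
        unfolding eq using le[of N] d[of N] by simp
    qed
    have "(\<lambda>N. 2 * (exp (2 * norm G) * 2 * (1 / 2 :: real) ^ N)) \<longlonglongrightarrow> 2 * (exp (2 * norm G) * 2 * 0)"
      by (intro tendsto_intros LIMSEQ_power_zero) auto
    then show "(\<lambda>N. 2 * (exp (2 * norm G) * 2 * (1 / 2 :: real) ^ N)) \<longlonglongrightarrow> 0" by simp
  qed
  ultimately show "\<exists>r>0. \<exists>A C. (\<forall>n. real_multilinear n (A n) \<and> multilinear_bounded n (A n) (C n)) \<and>
      summable (\<lambda>n. C n * r ^ n) \<and>
      (\<forall>h\<in>l1. l1_norm h < r \<longrightarrow>
        (\<lambda>N. A2_norm (pdiff (nlft (sadd x0 h)) (psum (\<lambda>n. A n (replicate n h)) N))) \<longlonglongrightarrow> 0)"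
    by (intro exI[of _ "1 / 10"] exI[of _ A] exI[of _ C] conjI allI ballI impI) auto
qed

theorem theorem5p2:
  "\<exists>\<Phi> :: seq \<Rightarrow> seq \<times> seq.
     (\<forall>F\<in>l1. \<Phi> F \<in> A2) \<and>
     (\<forall>F lo hi z. {k. F k \<noteq> 0} \<subseteq> {lo..hi} \<and> norm z = 1 \<longrightarrow>
        wiener_eval (fst (\<Phi> F)) z = fst (nlft_prod F lo hi z) \<and>
        wiener_eval (snd (\<Phi> F)) z = fst (snd (nlft_prod F lo hi z))) \<and>
     real_analytic_l1_A2 \<Phi> \<and>
     (\<forall>R F F'. R \<ge> 0 \<and> F \<in> l1 \<and> F' \<in> l1 \<and> l1_norm F \<le> R \<and> l1_norm F' \<le> R \<longrightarrow>
        l1_norm (sdiff (snd (\<Phi> F)) (snd (\<Phi> F'))) \<le> exp R * l1_norm (sdiff F F') \<and>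
        (R \<le> 0.36 \<longrightarrow> l1_norm (sdiff F F') \<le> 2 * l1_norm (sdiff (snd (\<Phi> F)) (snd (\<Phi> F')))))"
proof (intro exI[of _ nlft] conjI allI impI ballI; (elim conjE)?)
  fix F :: seq
  show "nlft F \<in> A2" by (simp add: nlft_def A2_def coeff)
next
  fix F :: seq and lo hi and z :: complex
  assume supp: "{k. F k \<noteq> 0} \<subseteq> {lo..hi}" and z: "norm z = 1"
  have "finite {k \<in> UNIV. norm (F k) \<noteq> 0}"
    using supp finite_subset by fastforce
  then have "F \<in> l1"
    unfolding l1_def mem_Collect_eq by (rule finite_nonzero_values_imp_summable_on)
  then have "meval z (nl.Ulim (Wiener F)) = nlft_prod F lo hi z"
    using meval_Ulim[OF z, of "Wiener F" lo hi] supp by (simp add: Wiener_inverse)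
  then show "wiener_eval (fst (nlft F)) z = fst (nlft_prod F lo hi z)"
    and "wiener_eval (snd (nlft F)) z = fst (snd (nlft_prod F lo hi z))"
    by (auto simp: meval_def[OF z] nlft_def weval_def dest: sym)
next
  show "real_analytic_l1_A2 nlft" by (rule real_analytic_nlft)
next
  fix R :: real and F F' :: seq
  assume *: "F \<in> l1" "F' \<in> l1" "l1_norm F \<le> R" "l1_norm F' \<le> R"
  define f f' where "f = Wiener F" and "f' = Wiener F'"
  have f: "norm f \<le> R" "norm f' \<le> R" "l1_norm (sdiff F F') = norm (f - f')"
    using * l1_norm_sdiff_coeff[of f f'] by (simp_all add: f_def f'_def l1_norm_Wiener Wiener_inverse)
  have b: "l1_norm (sdiff (snd (nlft F)) (snd (nlft F'))) = norm (snd (nl.Ulim f) - snd (nl.Ulim f'))"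
    by (simp add: nlft_def l1_norm_sdiff_coeff f_def f'_def)
  \<comment> \<open>The bound holds for the pair in the product norm, which dominates the norm of
    the second entry.\<close>
  show "l1_norm (sdiff (snd (nlft F)) (snd (nlft F'))) \<le> exp R * l1_norm (sdiff F F')"
    unfolding b f(3) using norm_snd_prod_le[of "nl.Ulim f - nl.Ulim f'"] nl.norm_Ulim_diff_le[OF f(1,2)] by simp
  assume "R \<le> 0.36"
  then show "l1_norm (sdiff F F') \<le> 2 * l1_norm (sdiff (snd (nlft F)) (snd (nlft F')))"
    unfolding b f(3) by (intro norm_diff_le_snd_Ulim[OF _ f(1,2)]) simp
qed

end
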